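(* Let $G$ be a 3-regular graph of girth at least 5. Then $\tau(G)<\alpha(G)$, and hence $$\max\{T_{M(G)}(2,0),\,T_{M(G)}(0,2)\}\ \ge\ T_{M(G)}(1,1).$$
   Context: Graphs are finite. For a matroid $M=(E,r)$, $T_M(x,y)=\sum_{A\subseteq E}(x-1)^{r(E)-r(A)}(y-1)^{|A|-r(A)}$ is the Tutte polynomial; $M(G)$ is the cycle (graphic) matroid of a graph $G$. $\alpha(G)=T_{M(G)}(2,0)$ is the number of acyclic orientations of $G$ (orientations with no directed cycle), and $\tau(G)=T_{M(G)}(1,1)$, which for connected $G$ is the number of spanning trees of $G$. *)

theory Defs
  imports Complex_Main "HOL-Library.FuncSet" "HOL-Library.Extended_Nat"
begin

(* Multigraphs, loops allowed: ends G e is the set of endpoints of the edge e,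
   a singleton exactly when e is a loop. *)

record ('v, 'e) mgraph =
  verts :: "'v set"
  edges :: "'e set"
  ends :: "'e \<Rightarrow> 'v set"

definition finite_graph :: "('v, 'e) mgraph \<Rightarrow> bool" where
  "finite_graph G \<longleftrightarrow> finite (verts G) \<and> finite (edges G) \<and>
     (\<forall>e \<in> edges G. ends G e \<subseteq> verts G \<and> card (ends G e) \<in> {1, 2})"

(* A loop contributes 2 to the degree of its endpoint. *)

definition degree :: "('v, 'e) mgraph \<Rightarrow> 'v \<Rightarrow> nat" where
  "degree G v = card {e \<in> edges G. v \<in> ends G e} + card {e \<in> edges G. ends G e = {v}}"

definition regular :: "nat \<Rightarrow> ('v, 'e) mgraph \<Rightarrow> bool" where
  "regular d G \<longleftrightarrow> (\<forall>v \<in> verts G. degree G v = d)"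

(* The cycle v_0 e_0 v_1 e_1 ... v_(k-1) e_(k-1) v_0 of length k \<ge> 1. A loop is a
   cycle of length 1 and two parallel edges form a cycle of length 2. *)

definition is_cycle :: "('v, 'e) mgraph \<Rightarrow> 'v list \<Rightarrow> 'e list \<Rightarrow> bool" where
  "is_cycle G vs es \<longleftrightarrow> es \<noteq> [] \<and> length vs = length es \<and> distinct vs \<and> distinct es \<and>
     set es \<subseteq> edges G \<and>
     (\<forall>i < length es. ends G (es ! i) = {vs ! i, vs ! (Suc i mod length es)})"

(* The girth of a graph without cycles is \<infinity>. *)

definition girth :: "('v, 'e) mgraph \<Rightarrow> enat" where
  "girth G = Inf {enat (length es) | vs es. is_cycle G vs es}"

(* A matroid M = (E, r) is represented by its ground set and its rank function;
   the type does not enforce the rank axioms. *)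

type_synonym 'e matroid = "'e set \<times> ('e set \<Rightarrow> nat)"

(* The exponents are natural numbers, so 0 ^ 0 = 1; neither subtraction truncates
   when r is the rank function of a matroid. *)

definition tutte :: "'e matroid \<Rightarrow> 'a::comm_ring_1 \<Rightarrow> 'a \<Rightarrow> 'a" where
  "tutte M x y = (case M of (E, r) \<Rightarrow>
     \<Sum>A \<in> Pow E. (x - 1) ^ (r E - r A) * (y - 1) ^ (card A - r A))"

definition forest :: "('v, 'e) mgraph \<Rightarrow> 'e set \<Rightarrow> bool" where
  "forest G F \<longleftrightarrow> F \<subseteq> edges G \<and> \<not> (\<exists>vs es. is_cycle G vs es \<and> set es \<subseteq> F)"

(* The independent sets of the cycle matroid are the edge sets of forests. *)

definition cycle_matroid :: "('v, 'e) mgraph \<Rightarrow> 'e matroid" where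
  "cycle_matroid G = (edges G, \<lambda>A. Max {card F | F. F \<subseteq> A \<and> forest G F})"

(* An orientation assigns to every edge a pair (tail, head). A loop gets only one
   orientation here, but no orientation of a graph with a loop is acyclic. *)

definition orientations :: "('v, 'e) mgraph \<Rightarrow> ('e \<Rightarrow> 'v \<times> 'v) set" where
  "orientations G = (\<Pi>\<^sub>E e \<in> edges G. {(u, v). ends G e = {u, v}})"

definition acyclic_orientations :: "('v, 'e) mgraph \<Rightarrow> ('e \<Rightarrow> 'v \<times> 'v) set" where
  "acyclic_orientations G = {h \<in> orientations G. acyclic (h ` edges G)}"

definition alpha :: "('v, 'e) mgraph \<Rightarrow> nat" where
  "alpha G = card (acyclic_orientations G)"

(* The number of bases of the cycle matroid, that is, of maximal spanning forests. *)

definition tau :: "('v, 'e) mgraph \<Rightarrow> real" where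
  "tau G = tutte (cycle_matroid G) 1 1"

end

theory Submission
  imports Defs "HOL-Library.Product_Lexorder"
begin

text \<open>
  Both \<open>\<alpha>\<close> and \<open>T(2,0)\<close> are at least \<open>\<Prod>v. (b v + 1)\<close> for every linear order of the vertices, where \<open>b v\<close>
  is the number of earlier neighbours of \<open>v\<close>: an acyclic orientation extends in at least \<open>b v + 1\<close>
  ways to a new vertex \<open>v\<close>, and a set with at most one back edge at every vertex contains no
  broken circuit (Whitney).

  For the upper bound on \<open>\<tau>\<close>, delete the bridges and root each remaining component. A spanning tree
  gives a parent function, in which no two vertices choose each other. If \<open>N X\<close> is the number of such
  functions on \<open>X\<close>, then \<open>N (X + v) \<le> d v * N X - (\<Sum>u. N (X - u))\<close>, the sum being over the neighbours
  \<open>u\<close> of \<open>v\<close> in \<open>X\<close>, and \<open>N (X - u) \<ge> 3/8 * N X\<close> if \<open>u\<close> has a neighbour in \<open>X\<close>, \<open>N (X - u) \<ge> 1/3 * N X\<close>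
  always. Ear decompositions give an order in which every component has one source and one sink and
  all other vertices have both earlier and later neighbours. Adding vertices in decreasing order,
  a vertex with two earlier neighbours and one later one costs \<open>21/8\<close> against a gain of \<open>3\<close>, one with
  one earlier and two later neighbours costs \<open>9/4\<close> against \<open>2\<close>. These types are
  balanced up to the source and sink, and \<open>21/8 * 9/4 < 3 * 2\<close>.
\<close>

section \<open>Bipolar orders of bridgeless graphs\<close>

lemma rtrancl_distinct_path:
  assumes "(u, v) \<in> R\<^sup>*"
  shows "\<exists>ps. ps \<noteq> [] \<and> hd ps = u \<and> last ps = v \<and> distinct ps \<and> successively (\<lambda>x y. (x, y) \<in> R) ps"
  using assms
proof (induction rule: converse_rtrancl_induct)
  case base
  show ?case by (rule exI[of _ "[v]"]) simp
next
  case (step u w)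
  then obtain ps where ps: "ps \<noteq> []" "hd ps = w" "last ps = v" "distinct ps"
    "successively (\<lambda>x y. (x, y) \<in> R) ps" by blast
  show ?case
  proof (cases "u \<in> set ps")
    case True
    then obtain as bs where "ps = as @ u # bs" by (meson split_list)
    with ps show ?thesis
      by (intro exI[of _ "u # bs"]) (auto simp: successively_append_iff)
  next
    case False
    with ps step(1) show ?thesis
      by (intro exI[of _ "u # ps"]) (auto simp: successively_Cons)
  qed
qed

text \<open>An open interval of reals is infinite, so the labels can be picked one after another,
  each above the last and outside the finite set \<open>Z\<close>. This is why orders are
  real-valued labellings: an ear fits between two old vertices without relabelling them.\<close>

lemma increasing_labels:
  fixes a b :: real
  assumes "finite Z" "a < b" "distinct qs"
  shows "\<exists>g. (\<forall>q\<in>set qs. a < g q \<and> g q < b \<and> g q \<notin> Z) \<and> sorted_wrt (\<lambda>u v. g u < g v) qs"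
  using assms(2,3)
proof (induction qs arbitrary: a)
  case Nil
  then show ?case by simp
next
  case (Cons q qs)
  have "infinite ({a<..<b} - Z)"
    using Cons.prems assms(1) by (simp add: infinite_Ioo)
  then obtain c where c: "c \<in> {a<..<b}" "c \<notin> Z"
    by (metis Diff_iff finite.emptyI ex_in_conv)
  obtain g where g: "\<forall>q\<in>set qs. c < g q \<and> g q < b \<and> g q \<notin> Z" "sorted_wrt (\<lambda>u v. g u < g v) qs"
    using Cons.IH[of c] Cons.prems c by auto
  have "sorted_wrt (\<lambda>u v. (g(q := c)) u < (g(q := c)) v) qs"
    using g(2) by (rule sorted_wrt_mono_rel[rotated]) (use Cons.prems in auto)
  then show ?case
    by (intro exI[of _ "g(q := c)"]) (use g c Cons.prems in \<open>force\<close>)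
qed

lemma sorted_wrt_less_inj_on:
  fixes g :: "'v \<Rightarrow> real"
  assumes "sorted_wrt (\<lambda>u v. g u < g v) qs"
  shows "inj_on g (set qs)"
proof (rule inj_onI)
  fix a b assume ab: "a \<in> set qs" "b \<in> set qs" "g a = g b"
  then obtain i j where ij: "i < length qs" "j < length qs" "a = qs ! i" "b = qs ! j"
    by (auto simp: in_set_conv_nth)
  then show "a = b"
    using ab(3) sorted_wrt_nth_less[OF assms, of i j] sorted_wrt_nth_less[OF assms, of j i]
    by (cases i j rule: linorder_cases) auto
qed

lemma successively_rtrancl:
  assumes "successively (\<lambda>u v. (u, v) \<in> R) ps" "q \<in> set ps"
  shows "(hd ps, q) \<in> R\<^sup>*"
  using assms
proof (induction ps)
  case (Cons p ps)
  then show ?case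
    by (cases ps) (auto intro: converse_rtrancl_into_rtrancl)
qed simp

text \<open>An order of the vertices placed so far, to be read per component of all of
  \<open>D\<close>, not of \<open>D\<close> restricted to \<open>W\<close>: reachability makes a
  source lowest and a sink highest in the part of its component inside \<open>W\<close>. The
  cardinality condition later pairs gains at sources with losses at sinks. The bound 2 on neighbours
  inside \<open>W\<close> rules out closed ears when degrees are at most 3.\<close>

definition bipolar_on ::
    "('v \<times> 'v) set \<Rightarrow> 'v set \<Rightarrow> ('v \<Rightarrow> real) \<Rightarrow> 'v set \<Rightarrow> 'v set \<Rightarrow> bool" where
  "bipolar_on D W \<rho> S T \<longleftrightarrow>
     W \<subseteq> Domain D \<and> inj_on \<rho> W \<and> S \<subseteq> W \<and> T \<subseteq> W \<and> card S = card T \<and>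
     (\<forall>s\<in>S. \<forall>w\<in>W. (s, w) \<in> D\<^sup>* \<longrightarrow> \<rho> s \<le> \<rho> w) \<and>
     (\<forall>t\<in>T. \<forall>w\<in>W. (t, w) \<in> D\<^sup>* \<longrightarrow> \<rho> w \<le> \<rho> t) \<and>
     (\<forall>v\<in>W - S. \<exists>u\<in>W. (v, u) \<in> D \<and> \<rho> u < \<rho> v) \<and>
     (\<forall>v\<in>W - T. \<exists>u\<in>W. (v, u) \<in> D \<and> \<rho> v < \<rho> u) \<and>
     (\<forall>v\<in>W. 2 \<le> card (D `` {v} \<inter> W))"

lemma bipolar_onD:
  assumes "bipolar_on D W \<rho> S T"
  shows "W \<subseteq> Domain D" "inj_on \<rho> W" "S \<subseteq> W" "T \<subseteq> W" "card S = card T"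
    and "\<And>s w. s \<in> S \<Longrightarrow> w \<in> W \<Longrightarrow> (s, w) \<in> D\<^sup>* \<Longrightarrow> \<rho> s \<le> \<rho> w"
    and "\<And>t w. t \<in> T \<Longrightarrow> w \<in> W \<Longrightarrow> (t, w) \<in> D\<^sup>* \<Longrightarrow> \<rho> w \<le> \<rho> t"
    and "\<And>v. v \<in> W \<Longrightarrow> v \<notin> S \<Longrightarrow> \<exists>u\<in>W. (v, u) \<in> D \<and> \<rho> u < \<rho> v"
    and "\<And>v. v \<in> W \<Longrightarrow> v \<notin> T \<Longrightarrow> \<exists>u\<in>W. (v, u) \<in> D \<and> \<rho> v < \<rho> u"
    and "\<And>v. v \<in> W \<Longrightarrow> 2 \<le> card (D `` {v} \<inter> W)"
  using assms by (simp_all add: bipolar_on_def)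

lemma two_le_cardI: "finite A \<Longrightarrow> a \<in> A \<Longrightarrow> b \<in> A \<Longrightarrow> a \<noteq> b \<Longrightarrow> 2 \<le> card A"
  using card_mono[of A "{a, b}"] by auto

section \<open>Ear decompositions of bridgeless graphs of maximum degree 3\<close>

locale bridgeless =
  fixes D :: "('v \<times> 'v) set"
  assumes fin: "finite D"
    and sym: "sym D"
    and irrefl: "(x, x) \<notin> D"
    and deg: "card (D `` {x}) \<le> 3"
    and no_bridge: "(x, y) \<in> D \<Longrightarrow> (y, x) \<in> (D - {(x, y), (y, x)})\<^sup>*"
begin

lemma finN: "finite (D `` {x})"
  using fin by (rule finite_Image)

lemma finDom: "finite (Domain D)"
  using fin by (rule finite_Domain)

lemma symD': "(x, y) \<in> D \<Longrightarrow> (y, x) \<in> D"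
  using sym by (rule symD)

lemma rtrancl_symD: "(x, y) \<in> D\<^sup>* \<Longrightarrow> (y, x) \<in> D\<^sup>*"
  using sym by (meson sym_rtrancl symD)

lemma sorted_wrt_neighbours:
  assumes "sorted_wrt (\<lambda>u v. g u < (g v :: real)) qs" "successively (\<lambda>u v. (u, v) \<in> D) qs" "q \<in> set qs"
  shows "q = hd qs \<or> (\<exists>u\<in>set qs. (q, u) \<in> D \<and> g u < g q)"
    and "q = last qs \<or> (\<exists>u\<in>set qs. (q, u) \<in> D \<and> g q < g u)"
proof -
  obtain as bs where qs: "qs = as @ q # bs" using assms(3) by (meson split_list)
  show "q = hd qs \<or> (\<exists>u\<in>set qs. (q, u) \<in> D \<and> g u < g q)"
  proof (cases as rule: rev_cases)
    case (snoc as' u)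
    then have "(q, u) \<in> D" "g u < g q" using assms(1,2) symD'
      by (auto simp: qs successively_append_iff sorted_wrt_append)
    then show ?thesis by (auto simp: qs snoc)
  qed (simp add: qs)
  show "q = last qs \<or> (\<exists>u\<in>set qs. (q, u) \<in> D \<and> g q < g u)"
  proof (cases bs)
    case (Cons u bs')
    then have "(q, u) \<in> D" "g q < g u" using assms(1,2)
      by (auto simp: qs successively_append_iff sorted_wrt_append)
    then show ?thesis by (auto simp: qs Cons)
  qed (simp add: qs)
qed

text \<open>Labels rising along the ear strictly between those of \<open>x\<close> and
  \<open>y\<close> give every new vertex its predecessor below and its successor above. Sources and
  sinks stay extreme: they already bound \<open>\<rho> x\<close> and \<open>\<rho> y\<close>, and
  the ear lies in the component of \<open>x\<close> and \<open>y\<close>.\<close>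

lemma bipolar_on_add_ear:
  assumes B: "bipolar_on D W \<rho> S T" and xy: "x \<in> W" "y \<in> W" "\<rho> x < \<rho> y"
    and qs: "qs \<noteq> []" "distinct qs" "set qs \<inter> W = {}" "successively (\<lambda>u v. (u, v) \<in> D) qs"
    and ends: "(x, hd qs) \<in> D" "(last qs, y) \<in> D"
  shows "\<exists>\<rho>'. bipolar_on D (W \<union> set qs) \<rho>' S T"
proof -
  note B' = bipolar_onD[OF B]
  have finW: "finite W" using B'(1) finDom by (rule finite_subset)
  obtain g where g: "\<And>q. q \<in> set qs \<Longrightarrow> \<rho> x < g q \<and> g q < \<rho> y \<and> g q \<notin> \<rho> ` W"
    "sorted_wrt (\<lambda>u v. g u < g v) qs"
    using increasing_labels[of "\<rho> ` W" "\<rho> x" "\<rho> y" qs] finW xy qs(2) by auto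
  define \<rho>' where "\<rho>' = (\<lambda>w. if w \<in> set qs then g w else \<rho> w)"
  have W': "\<And>w. w \<in> W \<Longrightarrow> \<rho>' w = \<rho> w" and Q': "\<And>w. w \<in> set qs \<Longrightarrow> \<rho>' w = g w"
    using qs(3) by (auto simp: \<rho>'_def)
  have inj_g: "inj_on g (set qs)" using g(2) by (rule sorted_wrt_less_inj_on)
  have inj: "inj_on \<rho>' (W \<union> set qs)"
  proof -
    have "inj_on \<rho>' W" "inj_on \<rho>' (set qs)"
      using B'(2) inj_g W' Q' by (simp_all cong: inj_on_cong)
    moreover have "\<rho>' ` W \<inter> \<rho>' ` set qs = {}"
      using g(1) by (force simp: W' Q')
    ultimately show ?thesis by (auto simp: inj_on_Un)
  qed
  have connx: "(x, q) \<in> D\<^sup>*" if "q \<in> set qs" for q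
    using successively_rtrancl[OF qs(4) that] ends(1) by (rule_tac converse_rtrancl_into_rtrancl)
  have conny: "(q, y) \<in> D\<^sup>*" if "q \<in> set qs" for q
    using rtrancl_symD[OF connx[OF that]] connx[of "last qs"] ends(2) qs(1)
    by (meson last_in_set rtrancl.rtrancl_into_rtrancl rtrancl_trans)
  have lower: "\<exists>u\<in>W \<union> set qs. (q, u) \<in> D \<and> \<rho>' u < \<rho>' q" if "q \<in> set qs" for q
    using sorted_wrt_neighbours(1)[OF g(2) qs(4) that]
  proof
    assume "q = hd qs"
    then show ?thesis using symD'[OF ends(1)] xy g(1)[OF that] W'[OF xy(1)] Q'[OF that] by auto
  next
    assume "\<exists>u\<in>set qs. (q, u) \<in> D \<and> g u < g q"
    then show ?thesis using Q' that by auto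
  qed
  have upper: "\<exists>u\<in>W \<union> set qs. (q, u) \<in> D \<and> \<rho>' q < \<rho>' u" if "q \<in> set qs" for q
    using sorted_wrt_neighbours(2)[OF g(2) qs(4) that]
  proof
    assume "q = last qs"
    then show ?thesis using ends(2) xy g(1)[OF that] W'[OF xy(2)] Q'[OF that] by auto
  next
    assume "\<exists>u\<in>set qs. (q, u) \<in> D \<and> g q < g u"
    then show ?thesis using Q' that by auto
  qed
  have "bipolar_on D (W \<union> set qs) \<rho>' S T"
    unfolding bipolar_on_def
  proof (intro conjI ballI impI)
    show "W \<union> set qs \<subseteq> Domain D" 
    proof -
      have "q \<in> Domain D" if "q \<in> set qs" for q
        using upper[OF that] by auto
      then show ?thesis using B'(1) by auto
    qed
    show "inj_on \<rho>' (W \<union> set qs)" by (fact inj)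
    show "S \<subseteq> W \<union> set qs" "T \<subseteq> W \<union> set qs" "card S = card T" using B'(3-5) by auto
  next
    fix s w assume a: "s \<in> S" "w \<in> W \<union> set qs" "(s, w) \<in> D\<^sup>*"
    then have "s \<in> W" using B'(3) by auto
    show "\<rho>' s \<le> \<rho>' w"
    proof (cases "w \<in> W")
      case True
      then show ?thesis using a B'(6) W' \<open>s \<in> W\<close> by auto
    next
      case False
      then have w: "w \<in> set qs" using a by auto
      then have "(s, x) \<in> D\<^sup>*" using a(3) rtrancl_symD[OF connx[OF w]] by (rule_tac rtrancl_trans)
      then have "\<rho> s \<le> \<rho> x" using a B'(6) xy by auto
      then show ?thesis using W'[OF \<open>s \<in> W\<close>] Q'[OF w] g(1)[OF w] by auto
    qed
  next
    fix t w assume a: "t \<in> T" "w \<in> W \<union> set qs" "(t, w) \<in> D\<^sup>*"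
    then have "t \<in> W" using B'(4) by auto
    show "\<rho>' w \<le> \<rho>' t"
    proof (cases "w \<in> W")
      case True
      then show ?thesis using a B'(7) W' \<open>t \<in> W\<close> by auto
    next
      case False
      then have w: "w \<in> set qs" using a by auto
      then have "(t, y) \<in> D\<^sup>*" using a(3) conny[OF w] by (rule_tac rtrancl_trans)
      then have "\<rho> y \<le> \<rho> t" using a B'(7) xy by auto
      then show ?thesis using W'[OF \<open>t \<in> W\<close>] Q'[OF w] g(1)[OF w] by auto
    qed
  next
    fix v assume "v \<in> W \<union> set qs - S"
    then show "\<exists>u\<in>W \<union> set qs. (v, u) \<in> D \<and> \<rho>' u < \<rho>' v"
      using lower B'(8)[of v] W' by (cases "v \<in> set qs") auto
  next
    fix v assume "v \<in> W \<union> set qs - T"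
    then show "\<exists>u\<in>W \<union> set qs. (v, u) \<in> D \<and> \<rho>' v < \<rho>' u"
      using upper B'(9)[of v] W' by (cases "v \<in> set qs") auto
  next
    fix v assume v: "v \<in> W \<union> set qs"
    show "2 \<le> card (D `` {v} \<inter> (W \<union> set qs))"
    proof (cases "v \<in> W")
      case True
      then have "2 \<le> card (D `` {v} \<inter> W)" by (rule B'(10))
      also have "\<dots> \<le> card (D `` {v} \<inter> (W \<union> set qs))"
        using finN by (intro card_mono) auto
      finally show ?thesis .
    next
      case False
      then obtain u1 u2 where "u1 \<in> W \<union> set qs" "(v, u1) \<in> D" "\<rho>' u1 < \<rho>' v"
        "u2 \<in> W \<union> set qs" "(v, u2) \<in> D" "\<rho>' v < \<rho>' u2"
        using lower[of v] upper[of v] v by blast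
      then show ?thesis using finN by (intro two_le_cardI[of _ u1 u2]) auto
    qed
  qed
  then show ?thesis by blast
qed

text \<open>\<open>W\<close> is a union of components, so the cycle starts a new one. Labelled in
  cyclic order above all of \<open>W\<close>, its first vertex becomes a source and its last a sink;
  length at least 3 makes the two cycle neighbours of each of them distinct.\<close>

lemma bipolar_on_add_cycle:
  assumes B: "bipolar_on D W \<rho> S T" and closed: "\<And>u v. (u, v) \<in> D \<Longrightarrow> u \<in> W \<Longrightarrow> v \<in> W"
    and qs: "qs \<noteq> []" "distinct qs" "hd qs \<notin> W" "successively (\<lambda>u v. (u, v) \<in> D) qs"
    and ends: "(last qs, hd qs) \<in> D" "3 \<le> length qs"
  shows "\<exists>\<rho>'. bipolar_on D (W \<union> set qs) \<rho>' (insert (hd qs) S) (insert (last qs) T)"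
proof -
  note B' = bipolar_onD[OF B]
  have finW: "finite W" using B'(1) finDom by (rule finite_subset)
  have closed_rtrancl: "v \<in> W" if "(u, v) \<in> D\<^sup>*" "u \<in> W" for u v
    using that by (induction rule: rtrancl_induct) (auto intro: closed)
  have "\<exists>M. \<forall>w\<in>W. \<rho> w < M"
    using finW by (intro exI[of _ "Max (\<rho> ` W) + 1"]) (auto intro: order.strict_trans1[OF Max_ge])
  then obtain M where M: "\<And>w. w \<in> W \<Longrightarrow> \<rho> w < M" by blast
  obtain g where g: "\<And>q. q \<in> set qs \<Longrightarrow> M < g q" "sorted_wrt (\<lambda>u v. g u < g v) qs"
    using increasing_labels[of "{}" M "M + 1" qs] qs(2) by auto
  have conn: "(hd qs, q) \<in> D\<^sup>*" if "q \<in> set qs" for q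
    using qs(4) that by (rule successively_rtrancl)
  have disj: "set qs \<inter> W = {}"
    using conn rtrancl_symD closed_rtrancl qs(3) by blast
  define \<rho>' where "\<rho>' = (\<lambda>w. if w \<in> set qs then g w else \<rho> w)"
  have W': "\<And>w. w \<in> W \<Longrightarrow> \<rho>' w = \<rho> w" and Q': "\<And>w. w \<in> set qs \<Longrightarrow> \<rho>' w = g w"
    using disj by (auto simp: \<rho>'_def)
  have inj_g: "inj_on g (set qs)" using g(2) by (rule sorted_wrt_less_inj_on)
  have inj: "inj_on \<rho>' (W \<union> set qs)"
  proof -
    have "inj_on \<rho>' W" "inj_on \<rho>' (set qs)"
      using B'(2) inj_g W' Q' by (simp_all cong: inj_on_cong)
    moreover have "\<rho>' ` W \<inter> \<rho>' ` set qs = {}"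
      using g(1) M by (force simp: W' Q')
    ultimately show ?thesis by (auto simp: inj_on_Un)
  qed
  have hl: "hd qs \<in> set qs" "last qs \<in> set qs" using qs(1) by auto
  have hdmin: "g (hd qs) \<le> g q" if "q \<in> set qs" for q
    using g(2) that by (cases qs) auto
  have lastmax: "g q \<le> g (last qs)" if "q \<in> set qs" for q
    using g(2) that by (cases qs rule: rev_cases) (auto simp: sorted_wrt_append)
  have apart: False if "u \<in> W" "v \<in> set qs" "(u, v) \<in> D\<^sup>* \<or> (v, u) \<in> D\<^sup>*" for u v
    using that closed_rtrancl rtrancl_symD disj by blast
  have lower: "q = hd qs \<or> (\<exists>u\<in>W \<union> set qs. (q, u) \<in> D \<and> \<rho>' u < \<rho>' q)" if "q \<in> set qs" for q
    using sorted_wrt_neighbours(1)[OF g(2) qs(4) that] Q' that by auto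
  have upper: "q = last qs \<or> (\<exists>u\<in>W \<union> set qs. (q, u) \<in> D \<and> \<rho>' q < \<rho>' u)" if "q \<in> set qs" for q
    using sorted_wrt_neighbours(2)[OF g(2) qs(4) that] Q' that by auto
  define b where "b = qs ! 1"
  define c where "c = qs ! (length qs - 2)"
  have nth: "hd qs = qs ! 0" "last qs = qs ! (length qs - 1)"
    using qs(1) by (simp_all add: hd_conv_nth last_conv_nth)
  have step: "(qs ! i, qs ! Suc i) \<in> D" if "Suc i < length qs" for i
    using qs(4) that by (simp add: successively_conv_nth)
  have hl2: "(hd qs, b) \<in> D" "(last qs, c) \<in> D"
    using step[of 0] symD'[OF step[of "length qs - 2"]] ends(2)
    by (simp_all add: nth b_def c_def Suc_diff_le flip: numeral_2_eq_2 Suc_diff_Suc)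
  have bc: "b \<noteq> last qs" "c \<noteq> hd qs"
    using nth_eq_iff_index_eq[OF qs(2), of 1 "length qs - 1"] nth_eq_iff_index_eq[OF qs(2), of "length qs - 2" 0]
      qs(1) ends(2) by (auto simp: nth b_def c_def)
  have bcin: "b \<in> set qs" "c \<in> set qs"
    using ends(2) by (auto simp: b_def c_def)
  have "bipolar_on D (W \<union> set qs) \<rho>' (insert (hd qs) S) (insert (last qs) T)"
    unfolding bipolar_on_def
  proof (intro conjI ballI impI)
    show "W \<union> set qs \<subseteq> Domain D" 
    proof -
      have "q \<in> Domain D" if "q \<in> set qs" for q
        using upper[OF that] ends(1) by auto
      then show ?thesis using B'(1) by auto
    qed
    show "inj_on \<rho>' (W \<union> set qs)" by (fact inj)
    show "insert (hd qs) S \<subseteq> W \<union> set qs" "insert (last qs) T \<subseteq> W \<union> set qs"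
      using B'(3,4) hl by auto
    have "finite S" "finite T" "hd qs \<notin> S" "last qs \<notin> T"
      using B'(3,4) finW finite_subset hl disj by blast+
    then show "card (insert (hd qs) S) = card (insert (last qs) T)" using B'(3-5) by auto
  next
    fix s w assume a: "s \<in> insert (hd qs) S" "w \<in> W \<union> set qs" "(s, w) \<in> D\<^sup>*"
    show "\<rho>' s \<le> \<rho>' w"
    proof (cases "s \<in> W")
      case True
      then have "s \<in> S" "w \<in> W" using a apart hl disj by blast+
      then show ?thesis using a(3) B'(3,4,6,7) W' True by auto
    next
      case False
      then have s: "s = hd qs" "w \<in> set qs" using a B'(3,4) apart hl by blast+
      then show ?thesis using Q' hdmin hl by auto
    qed
  next
    fix t w assume a: "t \<in> insert (last qs) T" "w \<in> W \<union> set qs" "(t, w) \<in> D\<^sup>*"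
    show "\<rho>' w \<le> \<rho>' t"
    proof (cases "t \<in> W")
      case True
      then have "t \<in> T" "w \<in> W" using a apart hl disj by blast+
      then show ?thesis using a(3) B'(3,4,6,7) W' True by auto
    next
      case False
      then have s: "t = last qs" "w \<in> set qs" using a B'(3,4) apart hl by blast+
      then show ?thesis using Q' lastmax hl by auto
    qed
  next
    fix v assume v: "v \<in> W \<union> set qs - insert (hd qs) S"
    show "\<exists>u\<in>W \<union> set qs. (v, u) \<in> D \<and> \<rho>' u < \<rho>' v"
    proof (cases "v \<in> set qs")
      case False
      then have "v \<in> W - S" using v by auto
      then obtain u where "u \<in> W" "(v, u) \<in> D" "\<rho> u < \<rho> v" using B'(8) by blast
      then show ?thesis using W' \<open>v \<in> W - S\<close> by auto
    qed (use v lower in blast)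
  next
    fix v assume v: "v \<in> W \<union> set qs - insert (last qs) T"
    show "\<exists>u\<in>W \<union> set qs. (v, u) \<in> D \<and> \<rho>' v < \<rho>' u"
    proof (cases "v \<in> set qs")
      case False
      then have "v \<in> W - T" using v by auto
      then obtain u where "u \<in> W" "(v, u) \<in> D" "\<rho> v < \<rho> u" using B'(9) by blast
      then show ?thesis using W' \<open>v \<in> W - T\<close> by auto
    qed (use v upper in blast)
  next
    fix v assume v: "v \<in> W \<union> set qs"
    show "2 \<le> card (D `` {v} \<inter> (W \<union> set qs))"
    proof (cases "v \<in> W")
      case True
      then have "2 \<le> card (D `` {v} \<inter> W)" by (rule B'(10))
      also have "\<dots> \<le> card (D `` {v} \<inter> (W \<union> set qs))"
        using finN by (intro card_mono) auto
      finally show ?thesis .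
    next
      case False
      then have vq: "v \<in> set qs" using v by auto
      consider "v = hd qs" | "v = last qs" | "v \<noteq> hd qs" "v \<noteq> last qs" by blast
      then show ?thesis
      proof cases
        case 1
        then show ?thesis using symD'[OF ends(1)] hl2 bc bcin hl finN
          by (intro two_le_cardI[of _ b "last qs"]) auto
      next
        case 2
        then show ?thesis using ends(1) hl2 bc bcin hl finN
          by (intro two_le_cardI[of _ c "hd qs"]) auto
      next
        case 3
        then obtain u1 u2 where "u1 \<in> W \<union> set qs" "(v, u1) \<in> D" "\<rho>' u1 < \<rho>' v"
          "u2 \<in> W \<union> set qs" "(v, u2) \<in> D" "\<rho>' v < \<rho>' u2"
          using lower[OF vq] upper[OF vq] by blast
        then show ?thesis using finN by (intro two_le_cardI[of _ u1 u2]) auto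
      qed
    qed
  qed
  then show ?thesis by blast
qed

text \<open>If an edge leaves \<open>W\<close>, a return path avoiding it exists by
  \<open>no_bridge\<close>, and its segment before the first vertex of \<open>W\<close> is an ear.
  Otherwise \<open>W\<close> is a union of components, and a cycle through an edge outside it opens
  the next component.\<close>

lemma bipolar_on_extend:
  assumes B: "bipolar_on D W \<rho> S T" and W: "W \<noteq> Domain D"
  shows "\<exists>W' \<rho>' S' T'. bipolar_on D W' \<rho>' S' T' \<and> W \<subset> W'"
proof (cases "\<exists>x p. (x, p) \<in> D \<and> x \<in> W \<and> p \<notin> W")
  case True
  then obtain x p where xp: "(x, p) \<in> D" "x \<in> W" "p \<notin> W" by blast
  define R where "R = D - {(x, p), (p, x)}"
  obtain ps where ps: "ps \<noteq> []" "hd ps = p" "last ps = x" "distinct ps"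
    "successively (\<lambda>u v. (u, v) \<in> R) ps"
    using rtrancl_distinct_path[OF no_bridge[OF xp(1)]] unfolding R_def by blast
  define qs where "qs = takeWhile (\<lambda>v. v \<notin> W) ps"
  have "x \<in> set ps" using ps(1,3) last_in_set by blast
  then have "dropWhile (\<lambda>v. v \<notin> W) ps \<noteq> []" using xp(2) by auto
  then obtain y zs where yz: "dropWhile (\<lambda>v. v \<notin> W) ps = y # zs"
    by (cases "dropWhile (\<lambda>v. v \<notin> W) ps") auto
  then have y: "y \<in> W" by (metis hd_dropWhile list.distinct(1) list.sel(1))
  have split: "ps = qs @ y # zs" using yz unfolding qs_def by (metis takeWhile_dropWhile_id)
  have qs: "qs \<noteq> []" "hd qs = p" "set qs \<inter> W = {}" "distinct qs"
  proof -
    show "qs \<noteq> []" using split ps(1,2) xp(3) y by (cases qs) auto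
    then show "hd qs = p" using split ps(2) by simp
    show "set qs \<inter> W = {}" unfolding qs_def by (auto dest: set_takeWhileD)
    show "distinct qs" unfolding qs_def using ps(4) by (rule distinct_takeWhile)
  qed
  have R: "successively (\<lambda>u v. (u, v) \<in> R) qs" "(last qs, y) \<in> R"
    using ps(5) qs(1) by (auto simp: split successively_append_iff)
  then have D: "successively (\<lambda>u v. (u, v) \<in> D) qs" "(last qs, y) \<in> D"
    unfolding R_def by (auto elim: successively_mono)
  \<comment> \<open>A closed ear would give \<open>x\<close> four neighbours: two in
    \<open>W\<close>, and \<open>p\<close> and \<open>last qs\<close> outside \<open>W\<close>,
    which differ because the edge between \<open>x\<close> and \<open>p\<close> was removed from
    \<open>R\<close>.\<close>
  have "y \<noteq> x"
  proof
    assume [simp]: "y = x"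
    have "p \<noteq> last qs" using R(2) unfolding R_def by auto
    moreover have "2 \<le> card (D `` {x} \<inter> W)" using B xp(2) unfolding bipolar_on_def by auto
    moreover have "card (D `` {x} \<inter> W) + card {p, last qs} \<le> card (D `` {x})"
    proof -
      have "last qs \<notin> W" using qs(1,3) last_in_set by blast
      then have "card (D `` {x} \<inter> W) + card {p, last qs} = card ((D `` {x} \<inter> W) \<union> {p, last qs})"
        using finN xp(3) by (intro card_Un_disjoint[symmetric]) auto
      also have "\<dots> \<le> card (D `` {x})"
        using finN xp(1) D(2) symD' by (intro card_mono) auto
      finally show ?thesis .
    qed
    ultimately show False using deg[of x] by simp
  qed
  then have "\<rho> x \<noteq> \<rho> y" using B xp(2) y unfolding bipolar_on_def by (auto dest: inj_onD)
  \<comment> \<open>Ears are added upwards, so the ear is reversed when \<open>y\<close> is the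
    lower end.\<close>
  then have "\<exists>\<rho>'. bipolar_on D (W \<union> set qs) \<rho>' S T"
  proof (rule linorder_neqE)
    assume "\<rho> x < \<rho> y"
    then show ?thesis using bipolar_on_add_ear[OF B xp(2) y _ qs(1,4,3) D(1) _ D(2)] qs(2) xp(1) by simp
  next
    assume "\<rho> y < \<rho> x"
    moreover have "successively (\<lambda>u v. (u, v) \<in> D) (rev qs)"
      using D(1) by (auto elim: successively_mono intro: symD')
    ultimately show ?thesis
      using bipolar_on_add_ear[OF B y xp(2), of "rev qs"] qs D(2) symD' xp(1)
      by (simp add: hd_rev last_rev)
  qed
  moreover have "W \<subset> W \<union> set qs" using qs(1-3) xp(3) hd_in_set by blast
  ultimately show ?thesis by blast
next
  case False
  then have closed: "\<And>u v. (u, v) \<in> D \<Longrightarrow> u \<in> W \<Longrightarrow> v \<in> W" by blast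
  have "W \<subseteq> Domain D" using B unfolding bipolar_on_def by auto
  then obtain x p where xp: "(x, p) \<in> D" "x \<notin> W" using W by blast
  then have "p \<notin> W" using closed symD' by blast
  define R where "R = D - {(x, p), (p, x)}"
  obtain ps where ps: "ps \<noteq> []" "hd ps = p" "last ps = x" "distinct ps"
    "successively (\<lambda>u v. (u, v) \<in> R) ps"
    using rtrancl_distinct_path[OF no_bridge[OF xp(1)]] unfolding R_def by blast
  have D: "successively (\<lambda>u v. (u, v) \<in> D) ps"
    using ps(5) unfolding R_def by (auto elim: successively_mono)
  \<comment> \<open>A path on at most two vertices would mean \<open>p = x\<close> or consist of the
    removed edge.\<close>
  have "3 \<le> length ps"
  proof (rule ccontr)
    assume *: "\<not> 3 \<le> length ps"
    obtain a as where a: "ps = a # as" using ps(1) by (cases ps) auto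
    show False
    proof (cases as)
      case Nil
      then show False using a ps xp irrefl by auto
    next
      case (Cons b bs)
      then have "ps = [p, x]" using * a ps by (cases bs) auto
      then show False using ps(5) unfolding R_def by auto
    qed
  qed
  then have "\<exists>\<rho>'. bipolar_on D (W \<union> set ps) \<rho>' (insert (hd ps) S) (insert (last ps) T)"
    using bipolar_on_add_cycle[OF B closed ps(1,4) _ D] ps(2,3) \<open>p \<notin> W\<close> xp(1) by simp
  moreover have "W \<subset> W \<union> set ps" using ps(1,2) \<open>p \<notin> W\<close> hd_in_set by blast
  ultimately show ?thesis by blast
qed

theorem bipolar_order_exists: "\<exists>\<rho> S T. bipolar_on D (Domain D) \<rho> S T"
proof -
  have "bipolar_on D W \<rho> S T \<Longrightarrow> ?thesis" for W \<rho> S T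
  proof (induction "card (Domain D - W)" arbitrary: W \<rho> S T rule: less_induct)
    case less
    show ?case
    proof (cases "W = Domain D")
      case False
      then obtain W' \<rho>' S' T' where *: "bipolar_on D W' \<rho>' S' T'" "W \<subset> W'"
        using bipolar_on_extend[OF less.prems False] by metis
      then have "W' \<subseteq> Domain D" by (auto simp: bipolar_on_def)
      then have "card (Domain D - W') < card (Domain D - W)"
        using *(2) finDom by (intro psubset_card_mono) auto
      then show ?thesis using less.hyps[OF _ *(1)] by simp
    next
      case True
      with less.prems show ?thesis by metis
    qed
  qed
  moreover have "bipolar_on D {} (\<lambda>_. 0) {} {}" by (simp add: bipolar_on_def)
  ultimately show ?thesis by metis
qed

end

section \<open>Neighbour choices without mutual pairs\<close>

text \<open>The value \<open>g v\<close> may lie outside \<open>X\<close>: with \<open>X\<close> the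
  set of non-sources, a vertex may choose the source of its component as parent.\<close>

definition nonmutual :: "('v \<times> 'v) set \<Rightarrow> 'v set \<Rightarrow> ('v \<Rightarrow> 'v) set" where
  "nonmutual D X = {g \<in> (\<Pi>\<^sub>E v\<in>X. D `` {v}). \<forall>v\<in>X. g v \<in> X \<longrightarrow> g (g v) \<noteq> v}"

context bridgeless
begin

lemma finite_nonmutual: "finite X \<Longrightarrow> finite (nonmutual D X)"
  by (rule finite_subset[of _ "\<Pi>\<^sub>E v\<in>X. D `` {v}"]) (auto simp: nonmutual_def intro!: finite_PiE finN)

text \<open>A choice \<open>u\<close> at \<open>v\<close> and nonmutual choices \<open>h\<close> on
  \<open>X\<close> form a pair \<open>(u, h)\<close>. Such a pair comes from
  \<open>insert v X\<close> unless \<open>u \<in> X\<close> and \<open>h u = v\<close>, and every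
  nonmutual choice on \<open>X - {u}\<close> extends by \<open>h u = v\<close> to a pair of this bad
  kind.\<close>

lemma card_nonmutual_insert:
  assumes X: "finite X" "v \<notin> X"
  shows "card (nonmutual D (insert v X)) + (\<Sum>u\<in>D `` {v} \<inter> X. card (nonmutual D (X - {u})))
    \<le> card (D `` {v}) * card (nonmutual D X)"
proof -
  define P where "P = D `` {v} \<times> nonmutual D X"
  define \<phi> where "\<phi> = (\<lambda>g :: 'v \<Rightarrow> 'v. (g v, restrict g X))"
  define Q where "Q = (SIGMA u:D `` {v} \<inter> X. nonmutual D (X - {u}))"
  define \<psi> where "\<psi> = (\<lambda>(u, h :: 'v \<Rightarrow> 'v). (u, h(u := v)))"
  have finP: "finite P" unfolding P_def using finN finite_nonmutual[OF X(1)] by auto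
  have inj\<phi>: "inj_on \<phi> (nonmutual D (insert v X))"
  proof (rule inj_onI)
    fix g h assume gh: "g \<in> nonmutual D (insert v X)" "h \<in> nonmutual D (insert v X)" "\<phi> g = \<phi> h"
    have "g w = h w" if "w \<in> insert v X" for w
      using gh(3) that unfolding \<phi>_def by (auto dest: fun_cong[of _ _ w])
    then show "g = h" using gh(1,2) unfolding nonmutual_def by (auto intro: PiE_ext)
  qed
  have inj\<psi>: "inj_on \<psi> Q"
  proof (rule inj_onI)
    fix p q assume pq: "p \<in> Q" "q \<in> Q" "\<psi> p = \<psi> q"
    obtain u h h' where uh: "p = (u, h)" "q = (u, h')" "h(u := v) = h'(u := v)"
      using pq(3) by (cases p; cases q) (auto simp: \<psi>_def)
    have "h w = h' w" if "w \<in> X - {u}" for w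
      using fun_cong[OF uh(3), of w] that by simp
    then show "p = q" using pq(1,2) unfolding uh Q_def nonmutual_def by (auto intro: PiE_ext)
  qed
  have im\<phi>: "\<phi> ` nonmutual D (insert v X) \<subseteq> P"
    using X(2) by (auto simp: \<phi>_def P_def nonmutual_def)
  have im\<psi>: "\<psi> ` Q \<subseteq> P"
  proof (intro image_subsetI)
    fix p assume "p \<in> Q"
    then obtain u h where uh: "p = (u, h)" "(v, u) \<in> D" "u \<in> X" "h \<in> nonmutual D (X - {u})"
      by (auto simp: Q_def)
    have "(u, v) \<in> D" using uh(2) by (rule symD')
    then have "h(u := v) \<in> (\<Pi>\<^sub>E w\<in>X. D `` {w})"
      using uh(3,4) by (auto simp: nonmutual_def PiE_iff extensional_def)
    \<comment> \<open>The value \<open>v\<close> lies outside \<open>X\<close>, so the new choice at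
      \<open>u\<close> creates no mutual pair inside \<open>X\<close>.\<close>
    moreover have "(h(u := v)) ((h(u := v)) w) \<noteq> w" if "w \<in> X" "(h(u := v)) w \<in> X" for w
      using that uh(3,4) X(2) by (auto simp: nonmutual_def split: if_splits)
    ultimately show "\<psi> p \<in> P" using uh by (auto simp: \<psi>_def P_def nonmutual_def)
  qed
  have disj: "\<phi> ` nonmutual D (insert v X) \<inter> \<psi> ` Q = {}"
  proof (rule ccontr)
    assume "\<phi> ` nonmutual D (insert v X) \<inter> \<psi> ` Q \<noteq> {}"
    then obtain g u h where g: "g \<in> nonmutual D (insert v X)" "u \<in> X"
      "g v = u" "restrict g X = h(u := v)"
      by (auto simp: \<phi>_def \<psi>_def Q_def)
    have "g (g v) = v" using fun_cong[OF g(4), of u] g(2,3) by simp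
    then show False using g(1-3) by (simp add: nonmutual_def)
  qed
  have "card (nonmutual D (insert v X)) + (\<Sum>u\<in>D `` {v} \<inter> X. card (nonmutual D (X - {u})))
      = card (nonmutual D (insert v X)) + card Q"
    unfolding Q_def using X(1) by (subst card_SigmaI) (auto intro: finite_nonmutual)
  also have "\<dots> = card (\<phi> ` nonmutual D (insert v X)) + card (\<psi> ` Q)"
    by (simp add: card_image inj\<phi> inj\<psi>)
  also have "\<dots> = card (\<phi> ` nonmutual D (insert v X) \<union> \<psi> ` Q)"
    using finP im\<phi> im\<psi> disj by (intro card_Un_disjoint[symmetric]) (auto intro: finite_subset)
  also have "\<dots> \<le> card P" using finP im\<phi> im\<psi> by (intro card_mono) auto
  finally show ?thesis unfolding P_def by (simp add: card_cartesian_product)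
qed

lemma card_nonmutual_remove:
  assumes "finite X" "u \<in> X"
  shows "card (nonmutual D X) \<le> 3 * card (nonmutual D (X - {u}))"
proof -
  have "card (nonmutual D X) \<le> card (D `` {u}) * card (nonmutual D (X - {u}))"
    using card_nonmutual_insert[of "X - {u}" u] assms by (simp add: insert_absorb)
  also have "\<dots> \<le> 3 * card (nonmutual D (X - {u}))" using deg by simp
  finally show ?thesis .
qed

text \<open>The recurrence at \<open>u\<close>, keeping only the term of \<open>w\<close>, gives
  \<open>N X \<le> 3 * N Y - N (Y - {w})\<close> with \<open>Y = X - {u}\<close>. As
  \<open>N (Y - {w})\<close> is at least a third of \<open>N Y\<close>, the factor is
  \<open>3 - 1/3 = 8/3\<close>.\<close>

lemma card_nonmutual_remove_adjacent:
  assumes X: "finite X" "u \<in> X" "w \<in> X" and uw: "(u, w) \<in> D"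
  shows "3 * card (nonmutual D X) \<le> 8 * card (nonmutual D (X - {u}))"
proof -
  define Y where "Y = X - {u}"
  have w: "w \<in> D `` {u} \<inter> Y" using X uw irrefl by (auto simp: Y_def)
  have finY: "finite Y" using X by (simp add: Y_def)
  have "card (nonmutual D X) + card (nonmutual D (Y - {w}))
      \<le> card (nonmutual D X) + (\<Sum>u\<in>D `` {u} \<inter> Y. card (nonmutual D (Y - {u})))"
    using finN w by (intro add_left_mono member_le_sum) auto
  also have "\<dots> \<le> card (D `` {u}) * card (nonmutual D Y)"
    using card_nonmutual_insert[of Y u] X by (simp add: Y_def insert_absorb)
  also have "\<dots> \<le> 3 * card (nonmutual D Y)" using deg by simp
  finally show ?thesis
    using card_nonmutual_remove[OF finY, of w] w unfolding Y_def[symmetric] by auto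
qed

end

section \<open>Counting choices along a bipolar order\<close>

locale bipolar = bridgeless +
  fixes \<rho> :: "'a \<Rightarrow> real" and S T :: "'a set"
  assumes bipolar: "bipolar_on D (Domain D) \<rho> S T"
begin

lemmas bp = bipolar_onD[OF bipolar]

definition above :: "'a \<Rightarrow> 'a set" where
  "above v = {u \<in> D `` {v}. \<rho> v < \<rho> u}"

definition below :: "'a \<Rightarrow> 'a set" where
  "below v = {u \<in> D `` {v}. \<rho> u < \<rho> v}"

lemma finite_above: "finite (above v)" and finite_below: "finite (below v)"
  by (rule finite_subset[OF _ finN[of v]]; auto simp: above_def below_def)+

lemma DomainD: "(u, v) \<in> D \<Longrightarrow> u \<in> Domain D \<and> v \<in> Domain D"
  using symD' by auto

lemma source_less: "s \<in> S \<Longrightarrow> (s, u) \<in> D \<Longrightarrow> \<rho> s < \<rho> u"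
  using bp(6)[of s u] bp(2) bp(3) irrefl DomainD[of s u]
  by (metis inj_onD order_le_less r_into_rtrancl)

lemma sink_less: "t \<in> T \<Longrightarrow> (t, u) \<in> D \<Longrightarrow> \<rho> u < \<rho> t"
  using bp(7)[of t u] bp(2) bp(4) irrefl DomainD[of t u]
  by (metis inj_onD order_le_less r_into_rtrancl)

lemma two_le_deg: "v \<in> Domain D \<Longrightarrow> 2 \<le> card (D `` {v})"
  using bp(10)[of v] card_mono[OF finN, of "D `` {v} \<inter> Domain D" v] by auto

lemma above_below: "v \<in> Domain D \<Longrightarrow> card (above v) + card (below v) = card (D `` {v})"
proof -
  assume v: "v \<in> Domain D"
  have "D `` {v} \<subseteq> above v \<union> below v"
    using bp(2) irrefl v by (auto simp: above_def below_def dest: inj_onD DomainD) 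
      (metis DomainD inj_onD linorder_neqE)
  then have "D `` {v} = above v \<union> below v" by (auto simp: above_def below_def)
  moreover have "above v \<inter> below v = {}" by (auto simp: above_def below_def)
  ultimately show ?thesis by (simp add: card_Un_disjoint finite_above finite_below)
qed

text \<open>A lower bound for the ratio of the counts after and before deleting \<open>u\<close>,
  when everything above \<open>u\<close> is present: a non-sink has a higher neighbour, which gives
  3/8; at a sink only 1/3 is available.\<close>

definition \<theta> :: "'a \<Rightarrow> real" where
  "\<theta> u = (if u \<in> T then 1 / 3 else 3 / 8)"

definition factor :: "'a \<Rightarrow> real" where
  "factor v = card (D `` {v}) - (\<Sum>u\<in>above v. \<theta> u)"

lemma factor_nonneg: "0 \<le> factor v"
proof -
  have "(\<Sum>u\<in>above v. \<theta> u) \<le> (\<Sum>u\<in>above v. 1)"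
    by (intro sum_mono) (simp add: \<theta>_def)
  also have "\<dots> \<le> card (D `` {v})"
    using card_mono[OF finN, of "above v" v] by (auto simp: above_def)
  finally show ?thesis by (simp add: factor_def)
qed

text \<open>\<open>Y\<close> is an upper part of the order without the sources. Adding its lowest
  vertex \<open>v\<close> multiplies the bound by \<open>factor v\<close>, since all of
  \<open>above v\<close> is present: a vertex with a neighbour below it is never a source.\<close>

lemma card_nonmutual_le_prod:
  assumes "finite Y" "Y \<subseteq> Domain D - S"
    and "\<And>v u. v \<in> Y \<Longrightarrow> u \<in> Domain D - S \<Longrightarrow> \<rho> v < \<rho> u \<Longrightarrow> u \<in> Y"
  shows "card (nonmutual D Y) \<le> (\<Prod>v\<in>Y. factor v)"
  using assms
\<comment> \<open>The negated label makes each inserted vertex the lowest so far.\<close>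
proof (induction Y rule: finite_ranking_induct[where f = "\<lambda>v. - \<rho> v"])
  case empty
  show ?case by (simp add: nonmutual_def)
next
  case (insert v Y)
  show ?case
  proof (cases "v \<in> Y")
    case True
    then show ?thesis using insert by (simp add: insert_absorb)
  next
    case False
    have le: "\<rho> v \<le> \<rho> y" if "y \<in> Y" for y using insert.hyps(2)[OF that] by simp
    have closed: "u \<in> Y" if "y \<in> insert v Y" "u \<in> Domain D - S" "\<rho> y < \<rho> u" for y u
      using insert.prems(2)[OF that] that le by fastforce
    have IH: "card (nonmutual D Y) \<le> (\<Prod>v\<in>Y. factor v)"
      using insert.prems(1) closed by (intro insert.IH) blast+
    have not_S: "u \<in> Domain D - S" if "(x, u) \<in> D" "\<rho> x < \<rho> u" for x u
      using source_less[of u x] that symD' DomainD[OF that(1)] by fastforce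
    have above: "above v \<subseteq> D `` {v} \<inter> Y"
      using not_S closed[of v] by (auto simp: above_def)
    have \<theta>: "\<theta> u * card (nonmutual D Y) \<le> card (nonmutual D (Y - {u}))" if u: "u \<in> above v" for u
    proof (cases "u \<in> T")
      case True
      then show ?thesis
        using card_nonmutual_remove[OF insert.hyps(1), of u] u above by (auto simp: \<theta>_def)
    next
      case False
      have "u \<in> Y" using u above by auto
      \<comment> \<open>As \<open>Y\<close> is closed upwards, the higher neighbour of
        \<open>u\<close> lies in \<open>Y\<close> too, as the bound 3/8 requires.\<close>
      then obtain w where w: "(u, w) \<in> D" "\<rho> u < \<rho> w"
        using bp(9)[of u] False insert.prems(1) by auto
      then have "w \<in> Y" using closed[of u w] not_S \<open>u \<in> Y\<close> by blast
      then show ?thesis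
        using card_nonmutual_remove_adjacent[OF insert.hyps(1) \<open>u \<in> Y\<close> _ w(1)] False
        by (auto simp: \<theta>_def)
    qed
    have "card (nonmutual D (insert v Y)) + (\<Sum>u\<in>D `` {v} \<inter> Y. card (nonmutual D (Y - {u})))
        \<le> card (D `` {v}) * card (nonmutual D Y)"
      using card_nonmutual_insert[OF insert.hyps(1) False] .
    then have "real (card (nonmutual D (insert v Y)))
        + (\<Sum>u\<in>D `` {v} \<inter> Y. real (card (nonmutual D (Y - {u}))))
        \<le> card (D `` {v}) * card (nonmutual D Y)"
      by (simp flip: of_nat_sum of_nat_add of_nat_mult del: of_nat_mult)
    moreover have "(\<Sum>u\<in>above v. \<theta> u * card (nonmutual D Y))
        \<le> (\<Sum>u\<in>D `` {v} \<inter> Y. real (card (nonmutual D (Y - {u}))))"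
    proof -
      have "(\<Sum>u\<in>above v. \<theta> u * card (nonmutual D Y))
          \<le> (\<Sum>u\<in>above v. real (card (nonmutual D (Y - {u}))))"
        using \<theta> by (rule sum_mono)
      also have "\<dots> \<le> (\<Sum>u\<in>D `` {v} \<inter> Y. real (card (nonmutual D (Y - {u}))))"
        using above finN by (intro sum_mono2) auto
      finally show ?thesis .
    qed
    ultimately have "card (nonmutual D (insert v Y)) \<le> factor v * card (nonmutual D Y)"
      by (simp add: factor_def algebra_simps sum_distrib_left)
    also have "\<dots> \<le> factor v * (\<Prod>v\<in>Y. factor v)"
      using IH factor_nonneg by (intro mult_left_mono)
    finally show ?thesis using insert.hyps(1) False by simp
  qed
qed

text \<open>
  Every edge multiplies the bound at its lower end by the weight of its upper end and divides by it
  at the upper end. The weight \<open>9/8\<close> balances the two kinds of inner vertices; the larger weight at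
  sinks makes up for \<open>\<theta>\<close> being only \<open>1/3\<close> there. A sink then loses a factor of at most
  \<open>343/288\<close>, and a source gains at least \<open>81/64\<close>.
\<close>

definition weight :: "'a \<Rightarrow> real" where
  "weight u = (if u \<in> T then 7 / 6 else 9 / 8)"

text \<open>At most three neighbours with at least one on each side leave three cases. One neighbour
  below and two non-sinks above give equality, \<open>9/4 * 9/8 = 2 * (9/8)^2\<close>, so 9/8 is the
  least weight that works there; two below and a non-sink above would allow weights up to
  8/7.\<close>

lemma factor_bound_inner:
  assumes v: "v \<in> Domain D" "v \<notin> S" "v \<notin> T"
  shows "factor v * weight v ^ card (below v) \<le> (card (below v) + 1) * (\<Prod>u\<in>above v. weight u)"
proof -
  have "above v \<noteq> {}" "below v \<noteq> {}"
    using bp(8)[OF v(1,2)] bp(9)[OF v(1,3)] by (auto simp: above_def below_def)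
  then have "0 < card (above v)" "0 < card (below v)"
    using finite_above finite_below by (simp_all add: card_gt_0_iff)
  moreover have "card (above v) + card (below v) \<le> 3"
    using above_below[OF v(1)] deg[of v] by simp
  ultimately consider "card (above v) = 1" "card (below v) = 1" | "card (above v) = 1" "card (below v) = 2"
    | "card (above v) = 2" "card (below v) = 1" by linarith
  then show ?thesis
  proof cases
    case 1
    then obtain u where "above v = {u}" by (meson card_1_singletonE)
    then show ?thesis using 1 above_below[OF v(1)] v(3)
      by (simp add: factor_def weight_def \<theta>_def)
  next
    case 2
    then obtain u where "above v = {u}" by (meson card_1_singletonE)
    then show ?thesis using 2 above_below[OF v(1)] v(3)
      by (simp add: factor_def weight_def \<theta>_def power2_eq_square)
  next
    case 3
    then obtain u w where "above v = {u, w}" "u \<noteq> w" by (meson card_2_iff)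
    then show ?thesis using 3 above_below[OF v(1)] v(3)
      by (simp add: factor_def weight_def \<theta>_def)
  qed
qed

text \<open>With nothing above, \<open>factor v\<close> is the degree. The constant comes from
  degree 3, where \<open>3 * (7/6)^3 = 4 * 343/288\<close>.\<close>

lemma factor_bound_sink:
  assumes v: "v \<in> T"
  shows "factor v * weight v ^ card (below v)
    \<le> (card (below v) + 1) * (343 / 288) * (\<Prod>u\<in>above v. weight u)"
proof -
  have D: "v \<in> Domain D" using v bp(4) by auto
  have [simp]: "above v = {}" using sink_less[OF v] by (force simp: above_def)
  have "card (below v) = 2 \<or> card (below v) = 3"
    using above_below[OF D] two_le_deg[OF D] deg[of v] by auto
  then show ?thesis using above_below[OF D] v
    by (auto simp: factor_def weight_def power2_eq_square power3_eq_cube)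
qed

text \<open>A source makes no choice and so contributes no factor. Each of its at least two
  neighbours above passes down a weight of at least 9/8, and \<open>(9/8)^2 = 81/64\<close>.\<close>

lemma factor_bound_source:
  assumes v: "v \<in> S"
  shows "81 / 64 * weight v ^ card (below v) \<le> (card (below v) + 1) * (\<Prod>u\<in>above v. weight u)"
proof -
  have D: "v \<in> Domain D" using v bp(3) by auto
  have [simp]: "below v = {}" using source_less[OF v] by (force simp: below_def)
  have "81 / 64 = (9 / 8 :: real) ^ 2" by (simp add: power2_eq_square)
  also have "\<dots> \<le> (9 / 8) ^ card (above v)"
    using above_below[OF D] two_le_deg[OF D] by (intro power_increasing) auto
  also have "\<dots> = (\<Prod>u\<in>above v. 9 / 8)" by simp
  also have "\<dots> \<le> (\<Prod>u\<in>above v. weight u)"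
    by (intro prod_mono) (auto simp: weight_def)
  finally show ?thesis by simp
qed

lemma sources_sinks_disjoint: "S \<inter> T = {}"
proof (rule ccontr)
  assume "S \<inter> T \<noteq> {}"
  then obtain v where v: "v \<in> S" "v \<in> T" by blast
  then obtain u where "(v, u) \<in> D" using bp(3) by blast
  then show False using source_less sink_less v by fastforce
qed

text \<open>Both sides collect, over all edges, the weight of the upper end.\<close>

lemma prod_weight_swap:
  "(\<Prod>v\<in>Domain D. \<Prod>u\<in>above v. weight u) = (\<Prod>v\<in>Domain D. weight v ^ card (below v))"
proof -
  have a: "above v = {u \<in> Domain D. (v, u) \<in> D \<and> \<rho> v < \<rho> u}" for v
    using DomainD by (auto simp: above_def)
  have b: "below v = {u \<in> Domain D. (u, v) \<in> D \<and> \<rho> u < \<rho> v}" for v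
    using symD' by (auto simp: below_def)
  have "(\<Prod>v\<in>Domain D. \<Prod>u\<in>above v. weight u) = (\<Prod>u\<in>Domain D. \<Prod>v\<in>below u. weight u)"
    unfolding a b using finDom by (intro prod.swap_restrict)
  then show ?thesis by simp
qed

theorem card_nonmutual_less:
  assumes "D \<noteq> {}"
  shows "card (nonmutual D (Domain D - S)) < (\<Prod>v\<in>Domain D. card (below v) + 1)"
proof -
  have finS: "finite S" "finite T" using bp(3,4) finDom finite_subset by blast+
  have "Domain D \<noteq> {}" using assms by auto
  then obtain v where v: "v \<in> Domain D" "\<And>u. u \<in> Domain D \<Longrightarrow> \<rho> v \<le> \<rho> u"
    using finDom arg_min_if_finite(1)[of "Domain D" \<rho>] arg_min_least[of "Domain D" _ \<rho>] by metis
  \<comment> \<open>The lowest vertex has no neighbour below it, so it is a source; the strictness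
    of the final inequality rests on this.\<close>
  then have "S \<noteq> {}" using bp(8)[of v] by force
  then have k: "0 < card S" using finS by (simp add: card_gt_0_iff)
  define n where "n = real (card (nonmutual D (Domain D - S)))"
  define A where "A = (\<Prod>v\<in>Domain D. real (card (below v) + 1))"
  define P where "P = (\<Prod>v\<in>Domain D. weight v ^ card (below v))"
  have P: "0 < P" unfolding P_def by (intro prod_pos) (simp add: weight_def)
  have A: "0 < A" unfolding A_def by (intro prod_pos) simp
  \<comment> \<open>\<open>c\<close> enters the guaranteed gain 81/64 at sources, which have no
    factor; \<open>d\<close> carries the loss at sinks. There are as many sources as sinks, so gain
    and loss appear as powers with the same exponent.\<close>
  define c where "c = (\<lambda>v. if v \<in> S then 81 / 64 else factor v)"
  define d where "d = (\<lambda>v. if v \<in> T then 343 / 288 else 1 :: real)"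
  have "n * (81 / 64) ^ card S \<le> (\<Prod>v\<in>Domain D - S. factor v) * (81 / 64) ^ card S"
    unfolding n_def using finDom by (intro mult_right_mono card_nonmutual_le_prod) auto
  also have "\<dots> = (\<Prod>v\<in>Domain D - S. c v) * (\<Prod>v\<in>S. c v)"
    by (simp add: c_def)
  also have "\<dots> = (\<Prod>v\<in>Domain D. c v)"
    using bp(3) finDom by (simp add: prod.subset_diff)
  finally have 1: "n * (81 / 64) ^ card S \<le> (\<Prod>v\<in>Domain D. c v)" .
  have "(\<Prod>v\<in>Domain D. c v * weight v ^ card (below v))
      \<le> (\<Prod>v\<in>Domain D. (card (below v) + 1) * d v * (\<Prod>u\<in>above v. weight u))"
  proof (intro prod_mono conjI)
    fix v assume v: "v \<in> Domain D"
    show "0 \<le> c v * weight v ^ card (below v)"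
      using factor_nonneg by (simp add: c_def weight_def)
    show "c v * weight v ^ card (below v) \<le> (card (below v) + 1) * d v * (\<Prod>u\<in>above v. weight u)"
      using factor_bound_inner[OF v] factor_bound_sink[of v] factor_bound_source[of v]
        sources_sinks_disjoint by (auto simp: c_def d_def)
  qed
  then have "(\<Prod>v\<in>Domain D. c v) * P \<le> A * (\<Prod>v\<in>Domain D. d v) * P"
    unfolding P_def A_def by (simp only: prod.distrib prod_weight_swap)
  then have 2: "(\<Prod>v\<in>Domain D. c v) \<le> A * (\<Prod>v\<in>Domain D. d v)" using P by simp
  have "(\<Prod>v\<in>Domain D. d v) = (\<Prod>v\<in>Domain D - T. d v) * (\<Prod>v\<in>T. d v)"
    using bp(4) finDom by (simp add: prod.subset_diff)
  also have "\<dots> = (343 / 288) ^ card S" using bp(5) by (simp add: d_def)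
  finally have "n * (81 / 64) ^ card S \<le> A * (343 / 288) ^ card S" using 1 2 by simp
  also have "\<dots> < A * (81 / 64) ^ card S"
    using A k by (intro mult_strict_left_mono power_strict_mono) auto
  finally have "n < A" by simp
  then show ?thesis unfolding n_def A_def of_nat_prod[symmetric] of_nat_less_iff .
qed

end

section \<open>The cycle matroid of a simple graph\<close>

locale simple_graph =
  fixes G :: "('v, 'e) mgraph"
  assumes finite_verts: "finite (verts G)" and finite_edges: "finite (edges G)"
    and ends_subset: "e \<in> edges G \<Longrightarrow> ends G e \<subseteq> verts G"
    and card_ends: "e \<in> edges G \<Longrightarrow> card (ends G e) = 2"
    and inj_ends: "inj_on (ends G) (edges G)"
begin

section \<open>Paths, cycles and forests\<close>

definition adj :: "'e set \<Rightarrow> ('v \<times> 'v) set" where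
  "adj A = {(u, v). \<exists>e\<in>A. ends G e = {u, v}}"

lemma adjI: "e \<in> A \<Longrightarrow> ends G e = {u, v} \<Longrightarrow> (u, v) \<in> adj A"
  by (auto simp: adj_def)

lemma sym_adj: "sym (adj A)"
  by (auto simp: adj_def sym_def insert_commute)

lemma adj_commute: "(u, v) \<in> adj A \<longleftrightarrow> (v, u) \<in> adj A"
  by (auto simp: adj_def insert_commute)

lemma adj_mono: "A \<subseteq> B \<Longrightarrow> adj A \<subseteq> adj B"
  by (auto simp: adj_def)

lemma adj_rtrancl_commute: "(u, v) \<in> (adj A)\<^sup>* \<Longrightarrow> (v, u) \<in> (adj A)\<^sup>*"
  using sym_adj by (meson sym_rtrancl symD)

lemma ends_obtain:
  assumes "e \<in> edges G" obtains u v where "ends G e = {u, v}" "u \<noteq> v" "u \<in> verts G" "v \<in> verts G"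
  using card_ends[OF assms] ends_subset[OF assms] by (auto simp: card_2_iff)

lemma ends_neq: "e \<in> edges G \<Longrightarrow> ends G e = {u, v} \<Longrightarrow> u \<noteq> v"
  using card_ends[of e] by auto

lemma cycle_edges_subset: "is_cycle G vs es \<Longrightarrow> set es \<subseteq> edges G"
  by (simp add: is_cycle_def)

lemma add_mod_neq:
  fixes j k n :: nat
  assumes "j < n" "0 < k" "k < n"
  shows "(j + k) mod n \<noteq> j"
  using assms by (cases "j + k < n") (auto simp: mod_if)

lemma cycle_connects:
  assumes cyc: "is_cycle G vs es" and e: "e \<in> set es" "ends G e = {u, v}"
  shows "(u, v) \<in> (adj (set es - {e}))\<^sup>*"
proof -
  define n where "n = length es"
  obtain j where j: "j < n" "e = es ! j" using e(1) by (auto simp: in_set_conv_nth n_def)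
  have len: "length vs = n" and dist: "distinct es" and n: "0 < n"
    and edge: "\<And>i. i < n \<Longrightarrow> ends G (es ! i) = {vs ! i, vs ! (Suc i mod n)}"
    using cyc unfolding is_cycle_def n_def by auto
  \<comment> \<open>The walk around the cycle starts at the vertex after edge \<open>j\<close>. As
    \<open>i\<close> stays below \<open>n\<close>, it never uses edge \<open>j\<close>, and after
    \<open>n - 1\<close> steps it arrives at \<open>vs ! j\<close>.\<close>
  have reach: "i < n \<Longrightarrow> (vs ! ((j + 1) mod n), vs ! ((j + 1 + i) mod n)) \<in> (adj (set es - {e}))\<^sup>*" for i
  proof (induction i)
    case (Suc i)
    define k where "k = (j + 1 + i) mod n"
    have "k < n" "k \<noteq> j" using add_mod_neq[of j n "1 + i"] Suc.prems n j(1) by (simp_all add: k_def add.assoc)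
    then have "es ! k \<in> set es - {e}"
      using dist j by (simp add: nth_eq_iff_index_eq n_def)
    moreover have "Suc k mod n = (j + 1 + Suc i) mod n" by (simp add: k_def mod_Suc_eq)
    ultimately have "(vs ! k, vs ! ((j + 1 + Suc i) mod n)) \<in> adj (set es - {e})"
      using edge[OF \<open>k < n\<close>] by (intro adjI) auto
    then show ?case using Suc unfolding k_def by (auto intro: rtrancl_into_rtrancl)
  qed simp
  have "(j + 1 + (n - 1)) mod n = j" using j(1) by simp
  then have "(vs ! (Suc j mod n), vs ! j) \<in> (adj (set es - {e}))\<^sup>*"
    using reach[of "n - 1"] n by simp
  then show ?thesis
    using edge[OF j(1)] e(2) j(2) by (auto simp: doubleton_eq_iff intro: adj_rtrancl_commute)
qed

text \<open>A path without repeated vertices is closed by \<open>e\<close>. Its edges are distinct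
  because their pairs of consecutive vertices are, and \<open>e\<close> is not in
  \<open>A\<close>.\<close>

lemma connects_cycle:
  assumes conn: "(u, v) \<in> (adj A)\<^sup>*" and A: "A \<subseteq> edges G"
    and e: "e \<in> edges G" "e \<notin> A" "ends G e = {u, v}"
  shows "\<exists>vs es. is_cycle G vs es \<and> e \<in> set es \<and> set es \<subseteq> insert e A"
proof -
  obtain ps where ps: "ps \<noteq> []" "hd ps = u" "last ps = v" "distinct ps"
    "successively (\<lambda>x y. (x, y) \<in> adj A) ps"
    using rtrancl_distinct_path[OF conn] by blast
  define m where "m = length ps - 1"
  have "\<exists>f\<in>A. ends G f = {ps ! i, ps ! Suc i}" if "i < m" for i
    using ps(5) that by (auto simp: successively_conv_nth adj_def m_def)
  then obtain f where f: "\<And>i. i < m \<Longrightarrow> f i \<in> A" "\<And>i. i < m \<Longrightarrow> ends G (f i) = {ps ! i, ps ! Suc i}"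
    by metis
  define es where "es = map f [0..<m] @ [e]"
  have len: "length ps = Suc m" using ps(1) by (simp add: m_def)
  have idx: "a = b" if "ps ! a = ps ! b" "a \<le> m" "b \<le> m" for a b
    using ps(4) that len by (simp add: nth_eq_iff_index_eq)
  have "inj_on f {0..<m}"
  proof (rule inj_onI)
    fix i j assume ij: "i \<in> {0..<m}" "j \<in> {0..<m}" "f i = f j"
    then have "{ps ! i, ps ! Suc i} = {ps ! j, ps ! Suc j}" using f(2) by (metis atLeastLessThan_iff)
    then show "i = j"
      using ij idx[of i j] idx[of i "Suc j"] idx[of "Suc i" j] by (auto simp: doubleton_eq_iff)
  qed
  moreover have "i < m \<Longrightarrow> Suc i mod Suc m = Suc i" for i by simp
  ultimately have "is_cycle G ps es"
    using ps A e f len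
    by (auto simp: is_cycle_def es_def distinct_map nth_append less_Suc_eq hd_conv_nth last_conv_nth insert_commute)
  moreover have "e \<in> set es" "set es \<subseteq> insert e A" using f(1) by (auto simp: es_def)
  ultimately show ?thesis by blast
qed

lemma forest_edge_separates:
  assumes F: "forest G F" and e: "e \<in> F" "ends G e = {u, v}"
  shows "(u, v) \<notin> (adj (F - {e}))\<^sup>*"
proof
  assume "(u, v) \<in> (adj (F - {e}))\<^sup>*"
  then obtain vs es where "is_cycle G vs es" "set es \<subseteq> insert e (F - {e})"
    using connects_cycle[of u v "F - {e}" e] F e by (auto simp: forest_def)
  then show False using F e(1) unfolding forest_def by (metis insert_Diff)
qed

lemma forest_insert:
  assumes F: "forest G F" and e: "e \<in> edges G" "ends G e = {u, v}" and sep: "(u, v) \<notin> (adj F)\<^sup>*"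
  shows "forest G (insert e F)"
  unfolding forest_def
proof (intro conjI notI)
  show "insert e F \<subseteq> edges G" using F e by (auto simp: forest_def)
  assume "\<exists>vs es. is_cycle G vs es \<and> set es \<subseteq> insert e F"
  then obtain vs es where c: "is_cycle G vs es" "set es \<subseteq> insert e F" by blast
  then have "e \<in> set es" using F unfolding forest_def by blast
  then have "(u, v) \<in> (adj (set es - {e}))\<^sup>*" using cycle_connects[OF c(1)] e(2) by blast
  moreover have "adj (set es - {e}) \<subseteq> adj F" using c(2) by (intro adj_mono) auto
  ultimately show False using sep rtrancl_mono by blast
qed

lemma forest_subset: "forest G F \<Longrightarrow> F' \<subseteq> F \<Longrightarrow> forest G F'"
  unfolding forest_def by blast

lemma forest_empty: "forest G {}"
  unfolding forest_def is_cycle_def by auto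

section \<open>Rank and exchange along cycles\<close>

definition rank :: "'e set \<Rightarrow> nat" where
  "rank A = Max {card F | F. F \<subseteq> A \<and> forest G F}"

lemma cycle_matroid_eq: "cycle_matroid G = (edges G, rank)"
  by (simp add: cycle_matroid_def rank_def fun_eq_iff)

lemma finite_forest: "forest G F \<Longrightarrow> finite F"
  using finite_edges finite_subset unfolding forest_def by blast

lemma finite_forest_cards: "finite {card F | F. F \<subseteq> A \<and> forest G F}"
proof (rule finite_subset)
  show "{card F | F. F \<subseteq> A \<and> forest G F} \<subseteq> {..card (edges G)}"
    using finite_edges by (auto simp: forest_def intro: card_mono)
qed simp

lemma rank_ge: "F \<subseteq> A \<Longrightarrow> forest G F \<Longrightarrow> card F \<le> rank A"
  unfolding rank_def using finite_forest_cards by (intro Max_ge) auto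

lemma rank_obtain:
  obtains F where "F \<subseteq> A" "forest G F" "card F = rank A"
proof -
  have "{card F | F. F \<subseteq> A \<and> forest G F} \<noteq> {}" using forest_empty by auto
  then have "rank A \<in> {card F | F. F \<subseteq> A \<and> forest G F}"
    unfolding rank_def using finite_forest_cards by (intro Max_in)
  then show thesis using that by auto
qed

lemma rank_mono: "A \<subseteq> B \<Longrightarrow> rank A \<le> rank B"
  by (metis order_trans rank_ge rank_obtain)

lemma rank_le_card: "finite A \<Longrightarrow> rank A \<le> card A"
  by (metis card_mono rank_obtain)

lemma rank_forest: "forest G F \<Longrightarrow> rank F = card F"
  using rank_ge rank_le_card finite_forest by (meson order_antisym order_refl)

lemma forest_if_card_le_rank: "finite A \<Longrightarrow> card A \<le> rank A \<Longrightarrow> forest G A"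
  by (metis card_seteq rank_obtain)

text \<open>Exchange: if a largest forest \<open>F\<close> contains \<open>e\<close>, the rest of
  the cycle joins the ends of \<open>e\<close> while \<open>F - {e}\<close> does not, so some other
  edge \<open>c\<close> of the cycle joins two components of \<open>F - {e}\<close> and can replace
  \<open>e\<close>.\<close>

lemma rank_insert_cycle:
  assumes cyc: "is_cycle G vs es" and e: "e \<in> set es" and A: "set es - {e} \<subseteq> A"
  shows "rank (insert e A) = rank (A - {e})"
proof (rule order_antisym)
  obtain F where F: "F \<subseteq> insert e A" "forest G F" "card F = rank (insert e A)"
    by (rule rank_obtain)
  show "rank (insert e A) \<le> rank (A - {e})"
  proof (cases "e \<in> F")
    case False
    then show ?thesis using F rank_ge[of F "A - {e}"] by auto
  next
    case True
    define F0 where "F0 = F - {e}"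
    have F0: "forest G F0" using F(2) unfolding F0_def by (rule forest_subset) auto
    obtain u v where uv: "ends G e = {u, v}" 
      using ends_obtain[of e] cycle_edges_subset[OF cyc] e by (meson subsetD)
    have sep: "(u, v) \<notin> (adj F0)\<^sup>*"
      using forest_edge_separates[OF F(2) True uv] unfolding F0_def .
    have "\<not> adj (set es - {e}) \<subseteq> (adj F0)\<^sup>*"
      using cycle_connects[OF cyc e uv] sep rtrancl_subset_rtrancl by blast
    then obtain c a b where c: "c \<in> set es - {e}" "ends G c = {a, b}" "(a, b) \<notin> (adj F0)\<^sup>*"
      by (auto simp: adj_def)
    have "c \<notin> F0" using c by (auto dest: adjI)
    moreover have "forest G (insert c F0)"
      using forest_insert[OF F0 _ c(2,3)] cycle_edges_subset[OF cyc] c(1) by auto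
    moreover have "insert c F0 \<subseteq> A - {e}" using F(1) c(1) A by (auto simp: F0_def)
    ultimately have "Suc (card F0) \<le> rank (A - {e})"
      using rank_ge[of "insert c F0" "A - {e}"] finite_forest[OF F0] by simp
    then show ?thesis using F(3) True finite_forest[OF F(2)] by (simp add: F0_def card_Suc_Diff1)
  qed
qed (auto intro: rank_mono)

section \<open>Bases and the edges on cycles\<close>

definition bases :: "'e set set" where
  "bases = {F. forest G F \<and> card F = rank (edges G)}"

text \<open>Every term is a product of powers of 0, hence 1 when both exponents vanish and 0
  otherwise. With truncated subtraction, vanishing exponents say that \<open>A\<close> has full rank
  and is independent.\<close>

lemma tau_eq_card_bases: "tau G = card bases"
proof -
  have "tau G = (\<Sum>A\<in>Pow (edges G). 0 ^ (rank (edges G) - rank A) * 0 ^ (card A - rank A))"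
    by (simp add: tau_def tutte_def cycle_matroid_eq)
  also have "\<dots> = (\<Sum>A\<in>Pow (edges G). if A \<in> bases then 1 else 0)"
  proof (rule sum.cong)
    fix A assume "A \<in> Pow (edges G)"
    then have A: "A \<subseteq> edges G" "finite A" using finite_edges finite_subset by auto
    have "A \<in> bases \<longleftrightarrow> rank (edges G) \<le> rank A \<and> card A \<le> rank A"
    proof
      assume "A \<in> bases"
      then show "rank (edges G) \<le> rank A \<and> card A \<le> rank A"
        using rank_forest by (simp add: bases_def)
    next
      assume *: "rank (edges G) \<le> rank A \<and> card A \<le> rank A"
      then have "card A = rank (edges G)"
        using rank_mono[OF A(1)] rank_le_card[OF A(2)] by linarith
      then show "A \<in> bases"
        using * forest_if_card_le_rank[OF A(2)] by (simp add: bases_def)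
    qed
    then show "(0::real) ^ (rank (edges G) - rank A) * 0 ^ (card A - rank A) = (if A \<in> bases then 1 else 0)"
      by (auto simp: power_0_left)
  qed simp
  also have "\<dots> = card (Pow (edges G) \<inter> bases)"
    using finite_edges by (simp add: sum.If_cases Int_def)
  also have "Pow (edges G) \<inter> bases = bases" by (auto simp: bases_def forest_def)
  finally show ?thesis .
qed

text \<open>The edges that are not bridges.\<close>

definition core :: "'e set" where
  "core = \<Union> {set es | vs es. is_cycle G vs es}"

lemma core_subset: "core \<subseteq> edges G"
  using cycle_edges_subset by (auto simp: core_def)

lemma cycle_subset_core: "is_cycle G vs es \<Longrightarrow> set es \<subseteq> core"
  by (auto simp: core_def)

lemma adj_neq: "A \<subseteq> edges G \<Longrightarrow> (u, v) \<in> adj A \<Longrightarrow> u \<noteq> v"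
  using ends_neq by (auto simp: adj_def)

text \<open>The other edges of a cycle through \<open>e\<close> form the detour. None of them has
  the same ends as \<open>e\<close>, because there are no parallel edges.\<close>

lemma core_no_bridge:
  assumes "(x, y) \<in> adj core"
  shows "(y, x) \<in> (adj core - {(x, y), (y, x)})\<^sup>*"
proof -
  obtain e where e: "e \<in> core" "ends G e = {y, x}" using assms by (auto simp: adj_def insert_commute)
  obtain vs es where c: "is_cycle G vs es" "e \<in> set es" using e(1) by (auto simp: core_def)
  have "(a, b) \<in> adj core - {(x, y), (y, x)}" if ab: "(a, b) \<in> adj (set es - {e})" for a b
  proof -
    obtain f where f: "f \<in> set es - {e}" "ends G f = {a, b}"
      using ab unfolding adj_def by blast
    have "f \<in> edges G" "e \<in> edges G" using f(1) c cycle_edges_subset by auto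
    then have "{a, b} \<noteq> {y, x}" using f e(2) inj_ends by (metis DiffD2 inj_onD singletonI)
    moreover have "(a, b) \<in> adj core" using f cycle_subset_core[OF c(1)] by (auto simp: adj_def)
    ultimately show ?thesis by auto
  qed
  then have "adj (set es - {e}) \<subseteq> adj core - {(x, y), (y, x)}" by auto
  then show ?thesis using cycle_connects[OF c e(2)] rtrancl_mono by blast
qed

lemma base_contains_bridges:
  assumes "F \<in> bases"
  shows "edges G - core \<subseteq> F"
proof
  fix e assume e: "e \<in> edges G - core"
  show "e \<in> F"
  proof (rule ccontr)
    assume "e \<notin> F"
    have F: "forest G F" "card F = rank (edges G)" using assms by (auto simp: bases_def)
    have "forest G (insert e F)"
      using F(1) e unfolding forest_def core_def by blast
    then have "card (insert e F) \<le> rank (edges G)" by (intro rank_ge) (auto simp: forest_def)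
    then show False using F \<open>e \<notin> F\<close> finite_forest by simp
  qed
qed

text \<open>A forest of maximal size joins the ends of every edge. If \<open>e\<close> is not in
  \<open>F\<close>, the joining path closes with \<open>e\<close> to a cycle, so its edges lie in
  \<open>core\<close> and the path survives the restriction.\<close>

lemma base_connects:
  assumes F: "F \<in> bases" and uv: "(u, v) \<in> adj core"
  shows "(u, v) \<in> (adj (F \<inter> core))\<^sup>*"
proof -
  have F': "forest G F" "card F = rank (edges G)" using F by (auto simp: bases_def)
  obtain e where e: "e \<in> core" "ends G e = {u, v}" using uv by (auto simp: adj_def)
  show ?thesis
  proof (cases "e \<in> F")
    case True
    then show ?thesis using e by (auto intro!: adjI r_into_rtrancl)
  next
    case False
    have eG: "e \<in> edges G" using e core_subset by auto
    have "(u, v) \<in> (adj F)\<^sup>*"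
    proof (rule ccontr)
      assume "(u, v) \<notin> (adj F)\<^sup>*"
      then have "forest G (insert e F)" using forest_insert F'(1) eG e(2) by blast
      then have "card (insert e F) \<le> rank (edges G)" by (intro rank_ge) (auto simp: forest_def)
      then show False using F' False finite_forest by simp
    qed
    then obtain vs es where c: "is_cycle G vs es" "e \<in> set es" "set es \<subseteq> insert e F"
      using connects_cycle[of u v F e] F'(1) eG False e(2) by (auto simp: forest_def)
    have "adj (set es - {e}) \<subseteq> adj (F \<inter> core)"
      using c cycle_subset_core[OF c(1)] by (intro adj_mono) auto
    then show ?thesis using cycle_connects[OF c(1,2) e(2)] rtrancl_mono by blast
  qed
qed

end

section \<open>Bases as parent functions rooted at the sources\<close>

locale bipolar_graph = simple_graph G + bipolar "adj core" \<rho> S T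
  for G :: "('v, 'e) mgraph" and \<rho> S T
begin

lemma source_unique: "s \<in> S \<Longrightarrow> s' \<in> S \<Longrightarrow> (s, s') \<in> (adj core)\<^sup>* \<Longrightarrow> s = s'"
  using bp(6)[of s s'] bp(6)[of s' s] bp(2,3) adj_rtrancl_commute
  by (meson inj_onD order_antisym subsetD)

lemma source_reachable:
  assumes "v \<in> Domain (adj core)"
  shows "\<exists>s\<in>S. (v, s) \<in> (adj core)\<^sup>*"
proof -
  define C where "C = {w \<in> Domain (adj core). (v, w) \<in> (adj core)\<^sup>*}"
  have "finite C" "v \<in> C" using finDom assms by (auto simp: C_def)
  then obtain w where w: "w \<in> C" "\<And>u. u \<in> C \<Longrightarrow> \<rho> w \<le> \<rho> u"
    using arg_min_if_finite(1)[of C \<rho>] arg_min_least[of C _ \<rho>] by (metis empty_iff)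
  have "w \<in> S"
  proof (rule ccontr)
    assume "w \<notin> S"
    then obtain u where u: "u \<in> Domain (adj core)" "(w, u) \<in> adj core" "\<rho> u < \<rho> w"
      using bp(8)[of w] w(1) by (auto simp: C_def)
    then have "u \<in> C" using w(1) by (auto simp: C_def intro: rtrancl_into_rtrancl)
    then show False using w(2) u(3) by fastforce
  qed
  then show ?thesis using w(1) by (auto simp: C_def)
qed

text \<open>Each vertex chooses a neighbour along \<open>F \<inter> core\<close> that is strictly
  closer to the sources; decreasing distance forbids mutual choices. The chosen edges already
  connect every vertex to the only source of its component, so the forest \<open>F\<close> has no
  further edge in \<open>core\<close>, while it contains all bridges. Thus \<open>g\<close>
  determines \<open>F\<close>, which bounds the number of bases.\<close>

lemma base_parent_function:
  assumes F: "F \<in> bases"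
  shows "\<exists>g\<in>nonmutual (adj core) (Domain (adj core) - S).
    F = {e \<in> core. \<exists>v\<in>Domain (adj core) - S. ends G e = {v, g v}} \<union> (edges G - core)"
proof -
  define W where "W = Domain (adj core)"
  define R where "R = adj (F \<inter> core)"
  have forest: "forest G F" using F by (simp add: bases_def)
  have "adj core \<subseteq> R\<^sup>*" using base_connects[OF F] by (auto simp: R_def)
  then have conn: "(adj core)\<^sup>* \<subseteq> R\<^sup>*" by (rule rtrancl_subset_rtrancl)
  have R_core: "R \<subseteq> adj core" unfolding R_def by (intro adj_mono) auto
  \<comment> \<open>On \<open>W\<close> such an \<open>n\<close> exists, because \<open>R\<close>
    connects whatever the core connects and every component of the core has a source.\<close>
  define dist where "dist = (\<lambda>v. LEAST n. \<exists>s\<in>S. (v, s) \<in> R ^^ n)"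
  have step: "\<exists>u. (v, u) \<in> R \<and> dist u < dist v" if v: "v \<in> W - S" for v
  proof -
    have "\<exists>n. \<exists>s\<in>S. (v, s) \<in> R ^^ n"
      using source_reachable[of v] v conn unfolding W_def by (meson DiffD1 rtrancl_imp_relpow subsetD)
    then have "\<exists>s\<in>S. (v, s) \<in> R ^^ dist v" unfolding dist_def by (rule LeastI_ex)
    then obtain s where s: "s \<in> S" "(v, s) \<in> R ^^ dist v" by blast
    then obtain m where m: "dist v = Suc m" using v by (cases "dist v") auto
    then obtain u where u: "(v, u) \<in> R" "(u, s) \<in> R ^^ m" using s(2) by (metis relpow_Suc_D2)
    have "dist u \<le> m" unfolding dist_def using u(2) s(1) by (intro Least_le) auto
    then show ?thesis using u m by auto
  qed
  then obtain p where p: "\<And>v. v \<in> W - S \<Longrightarrow> (v, p v) \<in> R \<and> dist (p v) < dist v" by metis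
  define g where "g = restrict p (W - S)"
  have g: "(v, g v) \<in> R" "dist (g v) < dist v" if "v \<in> W - S" for v using p that by (auto simp: g_def)
  have gW: "g v \<in> W" if "v \<in> W - S" for v
    using g(1)[OF that] R_core DomainD unfolding W_def by blast
  define P where "P = {e \<in> core. \<exists>v\<in>W - S. ends G e = {v, g v}}"
  have P_F: "P \<subseteq> F"
  proof
    fix e assume "e \<in> P"
    then obtain v where v: "e \<in> core" "v \<in> W - S" "ends G e = {v, g v}" by (auto simp: P_def)
    obtain f where f: "f \<in> F \<inter> core" "ends G f = {v, g v}" using g(1)[OF v(2)] by (auto simp: R_def adj_def)
    then have "e = f" using v inj_ends core_subset by (metis IntD2 inj_onD subsetD)
    then show "e \<in> F" using f by auto
  qed
  have P_conn: "\<exists>s\<in>S. (x, s) \<in> (adj P)\<^sup>*" if "x \<in> W" for x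
    using that
  proof (induction "dist x" arbitrary: x rule: less_induct)
    case less
    show ?case
    proof (cases "x \<in> S")
      case False
      then have x: "x \<in> W - S" using less.prems by auto
      obtain s where s: "s \<in> S" "(g x, s) \<in> (adj P)\<^sup>*"
        using less.hyps[OF g(2)[OF x] gW[OF x]] by blast
      obtain f where f: "f \<in> F \<inter> core" "ends G f = {x, g x}" using g(1)[OF x] by (auto simp: R_def adj_def)
      then have "(x, g x) \<in> adj P" using x by (intro adjI[of f]) (auto simp: P_def)
      then show ?thesis using s by (meson converse_rtrancl_into_rtrancl)
    qed auto
  qed
  have F_P: "F \<inter> core \<subseteq> P"
  proof
    fix e assume e: "e \<in> F \<inter> core"
    show "e \<in> P"
    proof (rule ccontr)
      \<comment> \<open>Both ends of \<open>e\<close> reach a source inside \<open>P\<close>. Their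
        component has only one source, so \<open>P\<close> joins the ends and \<open>e\<close> would
        close a cycle in \<open>F\<close>.\<close>
      assume "e \<notin> P"
      obtain u v where uv: "ends G e = {u, v}" 
        using ends_obtain[of e] e core_subset by (meson IntD2 subsetD)
      have uv_adj: "(u, v) \<in> adj core" using e uv by (auto intro: adjI)
      then have "u \<in> W" "v \<in> W" using DomainD unfolding W_def by blast+
      then obtain s s' where s: "s \<in> S" "(u, s) \<in> (adj P)\<^sup>*" "s' \<in> S" "(v, s') \<in> (adj P)\<^sup>*"
        using P_conn by meson
      have "adj P \<subseteq> adj core" by (intro adj_mono) (auto simp: P_def)
      then have *: "(adj P)\<^sup>* \<subseteq> (adj core)\<^sup>*" by (rule rtrancl_mono)
      have "(s, u) \<in> (adj core)\<^sup>*" "(v, s') \<in> (adj core)\<^sup>*"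
        using s * adj_rtrancl_commute by blast+
      then have "(s, s') \<in> (adj core)\<^sup>*"
        using uv_adj by (meson rtrancl.rtrancl_into_rtrancl rtrancl_trans)
      then have "s = s'" using source_unique s by blast
      then have "(u, v) \<in> (adj P)\<^sup>*" using s adj_rtrancl_commute by (meson rtrancl_trans)
      moreover have "adj P \<subseteq> adj (F - {e})" using P_F \<open>e \<notin> P\<close> by (intro adj_mono) auto
      ultimately have "(u, v) \<in> (adj (F - {e}))\<^sup>*" using rtrancl_mono by blast
      then show False using forest_edge_separates[OF forest _ uv] e by blast
    qed
  qed
  have "F = P \<union> (edges G - core)"
    using F_P P_F base_contains_bridges[OF F] forest by (auto simp: forest_def)
  moreover have "g \<in> nonmutual (adj core) (W - S)"
  proof -
    have "g (g v) \<noteq> v" if "v \<in> W - S" "g v \<in> W - S" for v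
      using g(2)[OF that(1)] g(2)[OF that(2)] by auto
    then show ?thesis using g(1) R_core by (auto simp: nonmutual_def g_def)
  qed
  ultimately show ?thesis unfolding P_def W_def by blast
qed

lemma card_bases_le: "card bases \<le> card (nonmutual (adj core) (Domain (adj core) - S))"
proof (rule surj_card_le)
  show "finite (nonmutual (adj core) (Domain (adj core) - S))"
    using finDom by (intro finite_nonmutual) auto
  show "bases \<subseteq> (\<lambda>g. {e \<in> core. \<exists>v\<in>Domain (adj core) - S. ends G e = {v, g v}} \<union> (edges G - core))
      ` nonmutual (adj core) (Domain (adj core) - S)"
    using base_parent_function by blast
qed

end

section \<open>Acyclic orientations\<close>

text \<open>Removing maximal elements one at a time yields a chain of \<open>card N + 1\<close>
  downsets: if \<open>m\<close> is maximal, every downset of \<open>N - {m}\<close> is one of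
  \<open>N\<close>, and \<open>N\<close> itself is new.\<close>

lemma card_downsets:
  assumes "finite N" "acyclic r"
  shows "card N + 1 \<le> card {U. U \<subseteq> N \<and> (\<forall>a\<in>U. \<forall>b\<in>N. (b, a) \<in> r\<^sup>* \<longrightarrow> b \<in> U)}"
  using assms(1)
proof (induction "card N" arbitrary: N)
  case 0
  then have "{U. U \<subseteq> N \<and> (\<forall>a\<in>U. \<forall>b\<in>N. (b, a) \<in> r\<^sup>* \<longrightarrow> b \<in> U)} = {{}}" by auto
  then show ?case using 0 by simp
next
  case (Suc n)
  define down where "down = (\<lambda>N. {U. U \<subseteq> N \<and> (\<forall>a\<in>U. \<forall>b\<in>N. (b, a) \<in> r\<^sup>* \<longrightarrow> b \<in> U)})"
  have fin: "finite (down N)" using Suc.prems by (auto simp: down_def)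
  have "N \<noteq> {}" using Suc.hyps(2) by auto
  moreover have "asymp_on N (\<lambda>a b. (a, b) \<in> r\<^sup>+)"
  proof (rule asymp_onI)
    fix a b assume ab: "(a, b) \<in> r\<^sup>+"
    show "(b, a) \<notin> r\<^sup>+"
    proof
      assume "(b, a) \<in> r\<^sup>+"
      with ab have "(a, a) \<in> r\<^sup>+" by (rule trancl_trans)
      then show False using assms(2) by (simp add: acyclic_def)
    qed
  qed
  moreover have "transp_on N (\<lambda>a b. (a, b) \<in> r\<^sup>+)"
    by (rule transp_onI) (rule trancl_trans)
  ultimately have "\<exists>m\<in>N. \<forall>x\<in>N. x \<noteq> m \<longrightarrow> (m, x) \<notin> r\<^sup>+"
    using Suc.prems by (intro Finite_Set.bex_max_element)
  then obtain m where m: "m \<in> N" "\<And>x. x \<in> N \<Longrightarrow> x \<noteq> m \<Longrightarrow> (m, x) \<notin> r\<^sup>+" by blast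
  have "down (N - {m}) \<subseteq> down N"
  proof
    fix U assume U: "U \<in> down (N - {m})"
    have "(m, a) \<notin> r\<^sup>*" if "a \<in> U" for a
      using that U m(2)[of a] by (auto simp: down_def rtrancl_eq_or_trancl)
    then show "U \<in> down N" using U by (auto simp: down_def)
  qed
  moreover have "N \<in> down N" "N \<notin> down (N - {m})" using m(1) by (auto simp: down_def)
  ultimately have "Suc (card (down (N - {m}))) \<le> card (down N)"
    using card_mono[OF fin, of "insert N (down (N - {m}))"] fin finite_subset by fastforce
  moreover have "card (N - {m}) + 1 \<le> card (down (N - {m}))"
    unfolding down_def using Suc m(1) by (intro Suc.hyps(1)) auto
  ultimately show ?case using Suc.hyps(2) m(1) Suc.prems unfolding down_def by simp
qed

text \<open>A directed cycle through \<open>x\<close> would leave \<open>x\<close> into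
  \<open>V\<close> and return from there to \<open>U\<close> inside \<open>r\<close>, which
  \<open>sep\<close> excludes.\<close>

lemma acyclic_add_vertex:
  assumes r: "acyclic r" and x: "x \<notin> Field r" "x \<notin> U" "x \<notin> V"
    and sep: "\<And>u v. u \<in> U \<Longrightarrow> v \<in> V \<Longrightarrow> (v, u) \<notin> r\<^sup>*"
  shows "acyclic (r \<union> U \<times> {x} \<union> {x} \<times> V)"
proof -
  \<comment> \<open>A level function: 0 on vertices that can reach \<open>U\<close>, 1 at
    \<open>x\<close>, 2 elsewhere. It never falls along an edge and rises along every edge at
    \<open>x\<close>, so a closed walk uses edges of \<open>r\<close> only.\<close>
  define c :: "'a \<Rightarrow> nat" where
    "c = (\<lambda>a. if \<exists>u\<in>U. (a, u) \<in> r\<^sup>* then 0 else if a = x then 1 else 2)"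
  have cx: "c x = 1"
  proof -
    have "(x, u) \<notin> r\<^sup>*" if "u \<in> U" for u
      using that x by (metis FieldI1 converse_rtranclE)
    then show ?thesis by (auto simp: c_def)
  qed
  have cU: "c u = 0" if "u \<in> U" for u using that by (auto simp: c_def)
  have cV: "c v = 2" if "v \<in> V" for v using that sep x(3) by (auto simp: c_def)
  have step: "c a < c b \<or> c a \<le> c b \<and> (a, b) \<in> r" if "(a, b) \<in> r \<union> U \<times> {x} \<union> {x} \<times> V" for a b
  proof (cases "(a, b) \<in> r")
    case True
    then have "a \<noteq> x" "b \<noteq> x" using x(1) by (auto simp: Field_def)
    then have "c a \<le> c b"
      using True by (auto simp: c_def intro: converse_rtrancl_into_rtrancl)
    then show ?thesis using True by simp
  next
    case False
    then show ?thesis using that cx cU cV by auto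
  qed
  have "c a < c b \<or> c a \<le> c b \<and> (a, b) \<in> r\<^sup>+" if "(a, b) \<in> (r \<union> U \<times> {x} \<union> {x} \<times> V)\<^sup>+" for a b
    using that
  proof (induction rule: trancl_induct)
    case (base b)
    then show ?case using step by blast
  next
    case (step b d)
    then show ?case using \<open>\<And>a b. (a, b) \<in> r \<union> U \<times> {x} \<union> {x} \<times> V \<Longrightarrow> c a < c b \<or> c a \<le> c b \<and> (a, b) \<in> r\<close>[of b d]
      by (auto intro: trancl_into_trancl)
  qed
  then show ?thesis using r by (fastforce simp: acyclic_def)
qed

section \<open>Building acyclic orientations vertex by vertex\<close>

context simple_graph
begin

definition induced :: "'v set \<Rightarrow> 'e set" where
  "induced Y = {e \<in> edges G. ends G e \<subseteq> Y}"

definition acyclic_on :: "'v set \<Rightarrow> ('e \<Rightarrow> 'v \<times> 'v) set" where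
  "acyclic_on Y = {h \<in> (\<Pi>\<^sub>E e\<in>induced Y. {(u, v). ends G e = {u, v}}). acyclic (h ` induced Y)}"

definition star :: "'v set \<Rightarrow> 'v \<Rightarrow> 'e set" where
  "star Y x = {e \<in> edges G. \<exists>u\<in>Y. ends G e = {u, x}}"

lemma finite_induced: "finite (induced Y)"
  using finite_edges by (simp add: induced_def)

lemma finite_orientation_choices: "finite {(u, v). ends G e = {u, v}}"
proof (cases "\<exists>u v. ends G e = {u, v}")
  case True
  then obtain a b where "ends G e = {a, b}" by blast
  then have "{(u, v). ends G e = {u, v}} \<subseteq> {(a, b), (b, a)}" by (auto simp: doubleton_eq_iff)
  then show ?thesis by (rule finite_subset) simp
qed auto

lemma finite_acyclic_on: "finite (acyclic_on Y)"
  by (rule finite_subset[of _ "\<Pi>\<^sub>E e\<in>induced Y. {(u, v). ends G e = {u, v}}"])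
     (auto simp: acyclic_on_def intro!: finite_PiE finite_induced finite_orientation_choices)

text \<open>Given an acyclic orientation \<open>h\<close> on \<open>Y\<close>, pick a set
  \<open>U\<close> of neighbours of \<open>x\<close> that contains every neighbour from which one of
  its members can be reached. Edges between \<open>U\<close> and \<open>x\<close> are directed into
  \<open>x\<close>, the others at \<open>x\<close> away from it. There are at least
  \<open>card N + 1\<close> such \<open>U\<close>, and the result determines
  \<open>(h, U)\<close>.\<close>

lemma card_acyclic_on_insert:
  assumes x: "x \<notin> Y"
  shows "(card (star Y x) + 1) * card (acyclic_on Y) \<le> card (acyclic_on (insert x Y))"
proof -
  define N where "N = {u \<in> Y. \<exists>e\<in>edges G. ends G e = {u, x}}"
  define oth where "oth = (\<lambda>e. THE u. ends G e = {u, x})"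
  have oth_eq: "oth e = u" if "ends G e = {u, x}" for e u
    unfolding oth_def by (rule the_equality) (use that in \<open>auto simp: doubleton_eq_iff\<close>)
  have finN: "finite N"
    by (rule finite_subset[OF _ finite_verts]) (use ends_subset in \<open>auto simp: N_def\<close>)
  have ind: "induced (insert x Y) = induced Y \<union> star Y x"
  proof -
    have "e \<in> star Y x" if e: "e \<in> edges G" "ends G e \<subseteq> insert x Y" "\<not> ends G e \<subseteq> Y" for e
    proof -
      obtain u v where "ends G e = {u, v}" "u \<noteq> v" using ends_obtain[OF e(1)] by blast
      then show ?thesis using e unfolding star_def by (auto simp: insert_commute)
    qed
    then show ?thesis by (auto simp: induced_def star_def)
  qed
  have disj: "induced Y \<inter> star Y x = {}" using x by (auto simp: induced_def star_def)
  have cardN: "card N = card (star Y x)"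
  proof -
    have "bij_betw oth (star Y x) N"
    proof (rule bij_betw_imageI)
      show "inj_on oth (star Y x)"
      proof (rule inj_onI)
        fix e f assume ef: "e \<in> star Y x" "f \<in> star Y x" "oth e = oth f"
        obtain u w where uw: "ends G e = {u, x}" "ends G f = {w, x}" using ef(1,2) by (auto simp: star_def)
        then have "ends G e = ends G f" using ef(3) oth_eq by metis
        then show "e = f" using ef(1,2) inj_ends by (auto simp: star_def dest: inj_onD)
      qed
      show "oth ` star Y x = N"
      proof (intro equalityI subsetI)
        fix u assume "u \<in> oth ` star Y x"
        then obtain e w where "e \<in> edges G" "w \<in> Y" "ends G e = {w, x}" "u = oth e"
          by (auto simp: star_def)
        then show "u \<in> N" using oth_eq by (auto simp: N_def)
      next
        fix u assume "u \<in> N"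
        then obtain e where "e \<in> edges G" "u \<in> Y" "ends G e = {u, x}" by (auto simp: N_def)
        then have "e \<in> star Y x" "oth e = u" using oth_eq by (auto simp: star_def)
        then show "u \<in> oth ` star Y x" by blast
      qed
    qed
    then show ?thesis by (simp add: bij_betw_same_card)
  qed
  define down where "down = (\<lambda>r. {U. U \<subseteq> N \<and> (\<forall>a\<in>U. \<forall>b\<in>N. (b, a) \<in> r\<^sup>* \<longrightarrow> b \<in> U)})"
  define Q where "Q = (SIGMA h:acyclic_on Y. down (h ` induced Y))"
  \<comment> \<open>The default \<open>undefined\<close> keeps the new orientation extensional, as
    \<open>\<Pi>\<^sub>E\<close> demands.\<close>
  define ext where "ext = (\<lambda>(h :: 'e \<Rightarrow> 'v \<times> 'v, U). \<lambda>e. if e \<in> induced Y then h e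
    else if e \<in> star Y x then (if oth e \<in> U then (oth e, x) else (x, oth e)) else undefined)"
  have ext_Y: "ext (h, U) e = h e" if "e \<in> induced Y" for h U e using that by (simp add: ext_def)
  have ext_star: "ext (h, U) e = (if oth e \<in> U then (oth e, x) else (x, oth e))" if "e \<in> star Y x" for h U e
    using that disj by (auto simp: ext_def)
  have "inj_on ext Q"
  proof (rule inj_onI)
    fix p q assume pq: "p \<in> Q" "q \<in> Q" "ext p = ext q"
    obtain h U k V where hk: "p = (h, U)" "q = (k, V)" by fastforce
    have h: "h \<in> acyclic_on Y" "k \<in> acyclic_on Y" "U \<subseteq> N" "V \<subseteq> N"
      using pq(1,2) by (auto simp: hk Q_def down_def)
    have "h e = k e" if "e \<in> induced Y" for e
      using fun_cong[OF pq(3), of e] ext_Y[OF that] by (simp add: hk)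
    then have "h = k" using h unfolding acyclic_on_def by (auto intro: PiE_ext)
    moreover have "u \<in> U \<longleftrightarrow> u \<in> V" if "u \<in> N" for u
    proof -
      obtain e where e: "e \<in> edges G" "ends G e = {u, x}" "u \<in> Y" using \<open>u \<in> N\<close> by (auto simp: N_def)
      then have "e \<in> star Y x" "oth e = u" "u \<noteq> x" using oth_eq x by (auto simp: star_def)
      then show ?thesis using fun_cong[OF pq(3), of e] by (auto simp: hk ext_star split: if_splits)
    qed
    ultimately show "p = q" using h(3,4) by (auto simp: hk)
  qed
  moreover have "ext ` Q \<subseteq> acyclic_on (insert x Y)"
  proof (intro image_subsetI)
    fix p assume "p \<in> Q"
    then obtain h U where p: "p = (h, U)" "h \<in> acyclic_on Y" "U \<in> down (h ` induced Y)"
      by (auto simp: Q_def)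
    define r where "r = h ` induced Y"
    have hP: "h \<in> (\<Pi>\<^sub>E e\<in>induced Y. {(u, v). ends G e = {u, v}})" and ac: "acyclic r"
      using p(2) by (auto simp: acyclic_on_def r_def)
    have "ext p \<in> (\<Pi>\<^sub>E e\<in>induced (insert x Y). {(u, v). ends G e = {u, v}})"
    proof (rule PiE_I)
      fix e assume e: "e \<in> induced (insert x Y)"
      show "ext p e \<in> {(u, v). ends G e = {u, v}}"
      proof (cases "e \<in> induced Y")
        case True
        then show ?thesis using PiE_mem[OF hP True] unfolding p(1) ext_Y[OF True] by simp
      next
        case False
        then have s: "e \<in> star Y x" using e ind by auto
        then obtain u where u: "ends G e = {u, x}" by (auto simp: star_def)
        then show ?thesis using oth_eq[OF u] unfolding p(1) ext_star[OF s] by (auto simp: insert_commute)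
      qed
    next
      fix e assume "e \<notin> induced (insert x Y)"
      then show "ext p e = undefined" using ind by (simp add: p(1) ext_def)
    qed
    moreover have "acyclic (ext p ` induced (insert x Y))"
    proof (rule acyclic_subset)
      show "acyclic (r \<union> U \<times> {x} \<union> {x} \<times> (N - U))"
      proof (rule acyclic_add_vertex[OF ac])
        have "Field r \<subseteq> Y"
        proof
          fix a assume "a \<in> Field r"
          then obtain e u v where e: "e \<in> induced Y" "h e = (u, v)" "a = u \<or> a = v"
            unfolding r_def Field_def by (auto, metis+)
          then have "ends G e = {u, v}" using hP by (auto dest: PiE_mem)
          then show "a \<in> Y" using e by (auto simp: induced_def)
        qed
        then show "x \<notin> Field r" using x by auto
        show "x \<notin> U" "x \<notin> N - U" using p(3) x by (auto simp: down_def N_def)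
        show "(v, u) \<notin> r\<^sup>*" if "u \<in> U" "v \<in> N - U" for u v
          using that p(3) by (auto simp: down_def r_def)
      qed
      show "ext p ` induced (insert x Y) \<subseteq> r \<union> U \<times> {x} \<union> {x} \<times> (N - U)"
      proof (intro image_subsetI)
        fix e assume e: "e \<in> induced (insert x Y)"
        show "ext p e \<in> r \<union> U \<times> {x} \<union> {x} \<times> (N - U)"
        proof (cases "e \<in> induced Y")
          case True
          then show ?thesis by (simp add: p(1) ext_Y r_def)
        next
          case False
          then have s: "e \<in> star Y x" using e ind by auto
          then obtain u where u: "u \<in> Y" "e \<in> edges G" "ends G e = {u, x}" by (auto simp: star_def)
          then have "u \<in> N" by (auto simp: N_def)
          then show ?thesis using oth_eq[OF u(3)] by (simp add: p(1) ext_star[OF s])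
        qed
      qed
    qed
    ultimately show "ext p \<in> acyclic_on (insert x Y)" by (simp add: acyclic_on_def)
  qed
  ultimately have "card Q \<le> card (acyclic_on (insert x Y))"
    using finite_acyclic_on by (intro card_inj_on_le)
  moreover have "(card (star Y x) + 1) * card (acyclic_on Y) \<le> card Q"
  proof -
    have "card (star Y x) + 1 \<le> card (down (h ` induced Y))" if "h \<in> acyclic_on Y" for h
      unfolding down_def cardN[symmetric] using that finN
      by (intro card_downsets) (auto simp: acyclic_on_def)
    then have "(\<Sum>h\<in>acyclic_on Y. card (star Y x) + 1) \<le> (\<Sum>h\<in>acyclic_on Y. card (down (h ` induced Y)))"
      by (rule sum_mono)
    also have "\<dots> = card Q"
      unfolding Q_def using finN finite_acyclic_on
      by (subst card_SigmaI) (auto simp: down_def)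
    finally show ?thesis by (simp add: mult.commute)
  qed
  ultimately show ?thesis by simp
qed

definition back_edges :: "('v \<Rightarrow> real) \<Rightarrow> 'v \<Rightarrow> 'e set" where
  "back_edges \<rho> v = {e \<in> edges G. \<exists>u. ends G e = {u, v} \<and> \<rho> u < \<rho> v}"

text \<open>Vertices are inserted by increasing label, so all lower neighbours of the new vertex are
  present and every back edge belongs to its star.\<close>

lemma alpha_ge_prod:
  assumes \<rho>: "inj_on \<rho> (verts G)"
  shows "(\<Prod>v\<in>verts G. card (back_edges \<rho> v) + 1) \<le> alpha G"
proof -
  have "(\<Prod>v\<in>Y. card (back_edges \<rho> v) + 1) \<le> card (acyclic_on Y)"
    if "finite Y" "Y \<subseteq> verts G" "\<And>v u. v \<in> Y \<Longrightarrow> u \<in> verts G \<Longrightarrow> \<rho> u < \<rho> v \<Longrightarrow> u \<in> Y" for Y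
    using that
  proof (induction Y rule: finite_ranking_induct[where f = \<rho>])
    case empty
    \<comment> \<open>No edge has an empty set of ends, so the single empty orientation matches the
      empty product.\<close>
    have "induced {} = {}" using card_ends by (auto simp: induced_def) (metis card.empty zero_neq_numeral)
    then have "acyclic_on {} = {\<lambda>_. undefined}" by (auto simp: acyclic_on_def acyclic_def)
    then show ?case by simp
  next
    case (insert x Y)
    show ?case
    proof (cases "x \<in> Y")
      case True
      then show ?thesis using insert by (simp add: insert_absorb)
    next
      case False
      have IH: "(\<Prod>v\<in>Y. card (back_edges \<rho> v) + 1) \<le> card (acyclic_on Y)"
      proof (rule insert.IH)
        show "Y \<subseteq> verts G" using insert.prems(1) by simp
        fix v u assume vu: "v \<in> Y" "u \<in> verts G" "\<rho> u < \<rho> v"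
        then show "u \<in> Y" using insert.prems(2)[of v u] insert.hyps(2)[of v] by auto
      qed
      have "back_edges \<rho> x \<subseteq> star Y x"
        using insert.prems(2)[of x] ends_subset unfolding back_edges_def star_def by fastforce
      moreover have "finite (star Y x)" using finite_edges by (simp add: star_def)
      ultimately have "card (back_edges \<rho> x) + 1 \<le> card (star Y x) + 1" by (simp add: card_mono)
      then have "(card (back_edges \<rho> x) + 1) * (\<Prod>v\<in>Y. card (back_edges \<rho> v) + 1)
          \<le> (card (star Y x) + 1) * card (acyclic_on Y)"
        using IH by (rule mult_le_mono)
      also have "\<dots> \<le> card (acyclic_on (insert x Y))" by (rule card_acyclic_on_insert[OF False])
      finally show ?thesis using insert.hyps(1) False by simp
    qed
  qed
  from this[of "verts G"] have "(\<Prod>v\<in>verts G. card (back_edges \<rho> v) + 1) \<le> card (acyclic_on (verts G))"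
    using finite_verts by simp
  moreover have "induced (verts G) = edges G" using ends_subset by (auto simp: induced_def)
  ultimately show ?thesis
    by (simp add: alpha_def acyclic_orientations_def orientations_def acyclic_on_def)
qed

end

section \<open>Sets without broken circuits\<close>

text \<open>\<open>A\<close> contains the circuit \<open>C\<close> broken at its smallest element \<open>e\<close>; \<open>e\<close> itself may lie in \<open>A\<close>.\<close>

definition contains_broken :: "'e set set \<Rightarrow> ('e \<Rightarrow> 'k::linorder) \<Rightarrow> 'e set \<Rightarrow> 'e \<Rightarrow> bool" where
  "contains_broken \<C> k A e \<longleftrightarrow> (\<exists>C\<in>\<C>. e \<in> C \<and> (\<forall>c\<in>C. k e \<le> k c) \<and> C - {e} \<subseteq> A)"

text \<open>Whitney's sign-reversing involution: a set with a broken circuit is paired with the set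
  obtained by toggling the \<open>k\<close>-largest element at which it contains one. The term
  \<open>s\<close> changes sign, so only sets without broken circuits survive.\<close>

lemma sum_broken_cancel:
  fixes k :: "'e \<Rightarrow> 'k::linorder" and s :: "'e set \<Rightarrow> real"
  assumes E: "finite E" "\<And>C. C \<in> \<C> \<Longrightarrow> C \<subseteq> E" and k: "inj_on k E"
    and s: "\<And>C e A. C \<in> \<C> \<Longrightarrow> e \<in> C \<Longrightarrow> C - {e} \<subseteq> A \<Longrightarrow> A \<subseteq> E \<Longrightarrow> s (insert e A) = - s (A - {e})"
  shows "(\<Sum>A\<in>Pow E. s A) = (\<Sum>A | A \<subseteq> E \<and> (\<forall>e. \<not> contains_broken \<C> k A e). s A)"
proof -
  define M where "M = (\<lambda>A. {e. contains_broken \<C> k A e})"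
  define B where "B = {A. A \<subseteq> E \<and> M A \<noteq> {}}"
  have M_sub: "M A \<subseteq> E" for A using E(2) by (auto simp: M_def contains_broken_def)
  have finM: "finite (M A)" for A using E(1) M_sub finite_subset by blast
  \<comment> \<open>Toggling the largest element of \<open>M A\<close> leaves the part of \<open>M A\<close> above it unchanged.\<close>
  define p where "p = (\<lambda>A. arg_max_on k (M A))"
  have p: "p A \<in> M A" "\<And>e. e \<in> M A \<Longrightarrow> k e \<le> k (p A)" if "M A \<noteq> {}" for A
  proof -
    have "\<exists>m\<in>M A. \<forall>e\<in>M A. k e \<le> k m"
    proof -
      have "Max (k ` M A) \<in> k ` M A" using finM that by (intro Max_in) auto
      then obtain m where "m \<in> M A" "k m = Max (k ` M A)" by auto
      moreover have "\<forall>e\<in>M A. k e \<le> Max (k ` M A)" using finM by simp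
      ultimately show ?thesis by metis
    qed
    then obtain m where m: "m \<in> M A" "\<And>e. e \<in> M A \<Longrightarrow> k e \<le> k m" by blast
    have "p A \<in> M A \<and> (\<forall>e\<in>M A. k e \<le> k (p A))"
      unfolding p_def arg_max_on_def
      by (rule arg_maxI[of "\<lambda>x. x \<in> M A" m]) (use m in \<open>auto simp: not_less\<close>)
    then show "p A \<in> M A" "\<And>e. e \<in> M A \<Longrightarrow> k e \<le> k (p A)" by auto
  qed
  define toggle where "toggle = (\<lambda>e (A :: 'e set). if e \<in> A then A - {e} else insert e A)"
  \<comment> \<open>If \<open>e\<close> lay in \<open>C - {e'}\<close> with \<open>e'\<close>
    smallest in \<open>C\<close>, then \<open>k e = k e'\<close> and hence \<open>e = e'\<close>. So
    circuits broken at \<open>e'\<close> are unaffected by toggling an element that is not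
    larger.\<close>
  have M_toggle: "e' \<in> M (toggle e A) \<longleftrightarrow> e' \<in> M A" if "e \<in> E" "k e \<le> k e'" for e e' A
  proof -
    have "C - {e'} \<subseteq> toggle e A \<longleftrightarrow> C - {e'} \<subseteq> A"
      if C: "C \<in> \<C>" "e' \<in> C" "\<forall>c\<in>C. k e' \<le> k c" for C
    proof -
      have "e \<notin> C - {e'}"
      proof
        assume e: "e \<in> C - {e'}"
        then have "k e = k e'" using C(3) \<open>k e \<le> k e'\<close> by (intro order_antisym) auto
        moreover have "e' \<in> E" using E(2)[OF C(1)] C(2) by blast
        ultimately show False using inj_onD[OF k _ \<open>e \<in> E\<close>] e by auto
      qed
      then show ?thesis by (auto simp: toggle_def)
    qed
    then show ?thesis unfolding M_def contains_broken_def mem_Collect_eq by blast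
  qed
  have p_toggle: "p (toggle (p A) A) = p A" and B_toggle: "toggle (p A) A \<in> B" if A: "A \<in> B" for A
  proof -
    have nA: "M A \<noteq> {}" "A \<subseteq> E" using A by (auto simp: B_def)
    define A' where "A' = toggle (p A) A"
    have pE: "p A \<in> E" using p(1)[OF nA(1)] M_sub by blast
    have "p A \<in> M A'" using M_toggle[OF pE, of "p A"] p(1)[OF nA(1)] by (simp add: A'_def)
    then have nA': "M A' \<noteq> {}" by auto
    have "k (p A) \<le> k (p A')" using p(2)[OF nA'] \<open>p A \<in> M A'\<close> .
    then have "p A' \<in> M A" using M_toggle[OF pE, of "p A'"] p(1)[OF nA'] by (simp add: A'_def)
    then have "k (p A') \<le> k (p A)" using p(2)[OF nA(1)] by blast
    then have "k (p A') = k (p A)" using \<open>k (p A) \<le> k (p A')\<close> by simp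
    then show "p (toggle (p A) A) = p A"
      using k pE p(1)[OF nA'] M_sub unfolding A'_def by (meson inj_onD subsetD)
    show "toggle (p A) A \<in> B"
      using nA' nA(2) pE by (auto simp: B_def A'_def toggle_def)
  qed
  have toggle_toggle: "toggle e (toggle e A) = A" for e A by (auto simp: toggle_def)
  have sign: "s (toggle (p A) A) = - s A" if A: "A \<in> B" for A
  proof -
    have nA: "M A \<noteq> {}" "A \<subseteq> E" using A by (auto simp: B_def)
    obtain C where "C \<in> \<C>" "p A \<in> C" "C - {p A} \<subseteq> A"
      using p(1)[OF nA(1)] by (auto simp: M_def contains_broken_def)
    from s[OF this nA(2)] show ?thesis by (auto simp: toggle_def insert_absorb)
  qed
  have "(\<Sum>A\<in>B. s A) = (\<Sum>A\<in>B. - s A)"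
  proof (rule sum.reindex_bij_witness[where i = "\<lambda>A. toggle (p A) A" and j = "\<lambda>A. toggle (p A) A"])
    fix A assume "A \<in> B"
    then show "toggle (p (toggle (p A) A)) (toggle (p A) A) = A" "toggle (p A) A \<in> B"
      "toggle (p (toggle (p A) A)) (toggle (p A) A) = A" "toggle (p A) A \<in> B"
      "- s (toggle (p A) A) = s A"
      using p_toggle B_toggle toggle_toggle sign by simp_all
  qed
  then have zero: "(\<Sum>A\<in>B. s A) = 0" by (simp add: sum_negf)
  have "Pow E = B \<union> {A. A \<subseteq> E \<and> (\<forall>e. \<not> contains_broken \<C> k A e)}"
    by (auto simp: B_def M_def)
  moreover have "B \<inter> {A. A \<subseteq> E \<and> (\<forall>e. \<not> contains_broken \<C> k A e)} = {}"
    by (auto simp: B_def M_def)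
  moreover have "finite B" "finite {A. A \<subseteq> E \<and> (\<forall>e. \<not> contains_broken \<C> k A e)}"
    using E(1) by (auto simp: B_def)
  ultimately show ?thesis using zero by (simp add: sum.union_disjoint)
qed

section \<open>Broken circuits and T(2,0)\<close>

context simple_graph
begin

text \<open>The term of \<open>A\<close> is -1 to the power of its nullity. Toggling the smallest
  edge of a circuit whose other edges are present keeps the rank and changes the size by one. A set
  with a full cycle contains that cycle broken at its smallest edge, so the surviving sets are
  forests, each with term 1.\<close>

lemma tutte_2_0_eq:
  fixes k :: "'e \<Rightarrow> 'k::linorder"
  assumes k: "inj_on k (edges G)"
  shows "tutte (cycle_matroid G) 2 0 = real (card {A. A \<subseteq> edges G \<and>
    (\<forall>e. \<not> contains_broken {set es | vs es. is_cycle G vs es} k A e)})"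
proof -
  define \<C> where "\<C> = {set es | vs es. is_cycle G vs es}"
  define s :: "'e set \<Rightarrow> real" where "s = (\<lambda>A. (-1) ^ (card A - rank A))"
  have finA: "finite A" if "A \<subseteq> edges G" for A using that finite_edges finite_subset by blast
  have "tutte (cycle_matroid G) 2 0 = (\<Sum>A\<in>Pow (edges G). s A)"
    by (simp add: tutte_def cycle_matroid_eq s_def)
  also have "\<dots> = (\<Sum>A | A \<subseteq> edges G \<and> (\<forall>e. \<not> contains_broken \<C> k A e). s A)"
  proof (rule sum_broken_cancel)
    fix C e A assume *: "C \<in> \<C>" "e \<in> C" "C - {e} \<subseteq> A" "A \<subseteq> edges G"
    then obtain vs es where c: "is_cycle G vs es" "C = set es" by (auto simp: \<C>_def)
    have "rank (insert e A) = rank (A - {e})" using rank_insert_cycle[OF c(1)] * c(2) by blast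
    moreover have "card (insert e A) = Suc (card (A - {e}))"
      using finA[OF *(4)] by (rule card.insert_remove)
    moreover have "rank (A - {e}) \<le> card (A - {e})" using finA[OF *(4)] by (intro rank_le_card) auto
    ultimately show "s (insert e A) = - s (A - {e})" by (simp add: s_def Suc_diff_le)
  next
    fix C assume "C \<in> \<C>"
    then show "C \<subseteq> edges G" using cycle_edges_subset by (auto simp: \<C>_def)
  qed (use finite_edges k in auto)
  also have "\<dots> = (\<Sum>A | A \<subseteq> edges G \<and> (\<forall>e. \<not> contains_broken \<C> k A e). 1)"
  proof (rule sum.cong)
    fix A assume "A \<in> {A. A \<subseteq> edges G \<and> (\<forall>e. \<not> contains_broken \<C> k A e)}"
    then have A: "A \<subseteq> edges G" "\<And>e. \<not> contains_broken \<C> k A e" by auto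
    have "forest G A"
      unfolding forest_def
    proof (intro conjI notI)
      show "A \<subseteq> edges G" by (fact A)
      assume "\<exists>vs es. is_cycle G vs es \<and> set es \<subseteq> A"
      then obtain vs es where c: "is_cycle G vs es" "set es \<subseteq> A" by blast
      then have "set es \<noteq> {}" by (auto simp: is_cycle_def)
      then have "Min (k ` set es) \<in> k ` set es" by (intro Min_in) auto
      then obtain e where "e \<in> set es" "k e = Min (k ` set es)" by auto
      moreover have "\<forall>c\<in>set es. Min (k ` set es) \<le> k c" by simp
      ultimately have "e \<in> set es" "\<forall>c\<in>set es. k e \<le> k c" by metis+
      then have "contains_broken \<C> k A e"
        using c unfolding contains_broken_def \<C>_def by blast
      then show False using A(2) by blast
    qed
    then show "s A = 1" using rank_forest by (simp add: s_def)
  qed simp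
  finally show ?thesis by (simp add: \<C>_def)
qed

text \<open>Each vertex selects at most one of its back edges, and no resulting set contains a
  broken circuit: two cycle edges meet at the highest vertex \<open>m\<close> of the cycle, both
  with top \<open>m\<close>, so one of them is the edge \<open>e\<close> at which it is broken. As
  \<open>e\<close> is smallest in \<open>k\<close> and already has the highest top, every edge of
  the cycle contains \<open>m\<close>, which is impossible without parallel edges.\<close>

lemma tutte_2_0_ge_prod:
  assumes \<rho>: "inj_on \<rho> (verts G)"
  shows "real (\<Prod>v\<in>verts G. card (back_edges \<rho> v) + 1) \<le> tutte (cycle_matroid G) 2 0"
proof -
  define top where "top = (\<lambda>e. Max (\<rho> ` ends G e))"
  \<comment> \<open>Compared lexicographically: the upper end decides, and the lower end separates
    edges with the same top, which makes \<open>k\<close> injective.\<close>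
  define k where "k = (\<lambda>e. (top e, Min (\<rho> ` ends G e)))"
  have top: "top e = \<rho> v" and bot: "Min (\<rho> ` ends G e) = \<rho> u" if "ends G e = {u, v}" "\<rho> u < \<rho> v" for e u v
    using that by (simp_all add: top_def)
  have orient: "\<exists>u v. ends G e = {u, v} \<and> \<rho> u < \<rho> v \<and> u \<in> verts G \<and> v \<in> verts G"
    if e: "e \<in> edges G" for e
  proof -
    obtain u v where uv: "ends G e = {u, v}" "u \<noteq> v" "u \<in> verts G" "v \<in> verts G"
      using ends_obtain[OF e] by blast
    then have "\<rho> u \<noteq> \<rho> v" using \<rho> by (auto dest: inj_onD)
    then show ?thesis using uv by (metis insert_commute linorder_neqE)
  qed
  have inj_k: "inj_on k (edges G)"
  proof (rule inj_onI)
    fix e f assume ef: "e \<in> edges G" "f \<in> edges G" "k e = k f"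
    obtain u v where uv: "ends G e = {u, v}" "\<rho> u < \<rho> v" "u \<in> verts G" "v \<in> verts G"
      using orient[OF ef(1)] by blast
    obtain x y where xy: "ends G f = {x, y}" "\<rho> x < \<rho> y" "x \<in> verts G" "y \<in> verts G"
      using orient[OF ef(2)] by blast
    have "\<rho> v = \<rho> y" "\<rho> u = \<rho> x"
      using ef(3) top[OF uv(1,2)] top[OF xy(1,2)] bot[OF uv(1,2)] bot[OF xy(1,2)]
      by (simp_all add: k_def)
    then have "ends G e = ends G f" using uv xy \<rho> by (metis inj_onD)
    then show "e = f" using inj_ends ef by (auto dest: inj_onD)
  qed
  define \<C> where "\<C> = {set es | vs es. is_cycle G vs es}"
  define NBC where "NBC = {A. A \<subseteq> edges G \<and> (\<forall>e. \<not> contains_broken \<C> k A e)}"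
  define H where "H = (\<Pi>\<^sub>E v\<in>verts G. insert None (Some ` back_edges \<rho> v))"
  define sel where "sel = (\<lambda>h :: 'v \<Rightarrow> 'e option. {e. \<exists>v\<in>verts G. h v = Some e})"
  have fin_back: "finite (back_edges \<rho> v)" for v using finite_edges by (simp add: back_edges_def)
  have back_top: "top e = \<rho> v" if "e \<in> back_edges \<rho> v" for e v
    using that top by (auto simp: back_edges_def)
  have sel_back: "e \<in> back_edges \<rho> v" if "h \<in> H" "v \<in> verts G" "h v = Some e" for h v e
    using PiE_mem[OF that(1)[unfolded H_def] that(2)] that(3) by auto
  have "card H = (\<Prod>v\<in>verts G. card (back_edges \<rho> v) + 1)"
    unfolding H_def using finite_verts fin_back
    by (subst card_PiE) (auto intro!: prod.cong simp: card_image)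
  moreover have "inj_on sel H"
  proof (rule inj_onI)
    fix h h' assume hh: "h \<in> H" "h' \<in> H" "sel h = sel h'"
    have sub: "h v = Some e \<Longrightarrow> h' v = Some e"
      if h: "h \<in> H" "h' \<in> H" "sel h = sel h'" and v: "v \<in> verts G" for h h' v e
    proof -
      assume e: "h v = Some e"
      then have "e \<in> sel h'" using h v by (auto simp: sel_def)
      then obtain w where w: "w \<in> verts G" "h' w = Some e" by (auto simp: sel_def)
      have "\<rho> v = \<rho> w" using back_top sel_back[OF h(1) v e] sel_back[OF h(2) w] by metis
      then have "v = w" using \<rho> v w by (auto dest: inj_onD)
      then show "h' v = Some e" using w by simp
    qed
    have "h v = h' v" if "v \<in> verts G" for v
      using sub[OF hh that] sub[OF hh(2,1) hh(3)[symmetric] that] by (cases "h v"; cases "h' v") auto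
    then show "h = h'" using hh unfolding H_def by (auto intro: PiE_ext)
  qed
  moreover have "sel ` H \<subseteq> NBC"
  proof (intro image_subsetI)
    fix h assume h: "h \<in> H"
    have "\<not> contains_broken \<C> k (sel h) e" for e
    proof
      assume "contains_broken \<C> k (sel h) e"
      then obtain vs es where c: "is_cycle G vs es" and e: "e \<in> set es" "\<And>c. c \<in> set es \<Longrightarrow> k e \<le> k c"
        and sub: "set es - {e} \<subseteq> sel h" by (auto simp: contains_broken_def \<C>_def)
      have esE: "set es \<subseteq> edges G" using cycle_edges_subset[OF c] .
      have len: "length vs = length es" "distinct es" "distinct vs" "es \<noteq> []"
        and edge: "\<And>i. i < length es \<Longrightarrow> ends G (es ! i) = {vs ! i, vs ! (Suc i mod length es)}"
        using c by (auto simp: is_cycle_def)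
      define n where "n = length es"
      obtain i where i: "i < n" "\<And>j. j < n \<Longrightarrow> \<rho> (vs ! j) \<le> \<rho> (vs ! i)"
      proof -
        have "Max ((\<lambda>j. \<rho> (vs ! j)) ` {..<n}) \<in> (\<lambda>j. \<rho> (vs ! j)) ` {..<n}"
          using len(4) by (intro Max_in) (auto simp: n_def)
        then obtain i where "i < n" "\<rho> (vs ! i) = Max ((\<lambda>j. \<rho> (vs ! j)) ` {..<n})" by auto
        then show thesis using that by auto
      qed
      define m where "m = vs ! i"
      have top_le: "top c \<le> \<rho> m" if "c \<in> set es" for c
      proof -
        obtain j where "j < n" "c = es ! j" using \<open>c \<in> set es\<close> by (auto simp: in_set_conv_nth n_def)
        moreover have "Suc j mod n < n" using i(1) by simp
        ultimately show ?thesis using i(2)[of j] i(2)[of "Suc j mod n"] edge[of j] by (auto simp: top_def m_def n_def)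
      qed
      \<comment> \<open>The cyclic predecessor of \<open>i\<close>; adding \<open>n\<close> first
        avoids truncation at \<open>i = 0\<close>. The edges \<open>es ! i'\<close> and
        \<open>es ! i\<close> are the two that meet at \<open>m\<close>.\<close>
      define i' where "i' = (i + n - 1) mod n"
      have "n \<noteq> 1"
      proof
        assume "n = 1"
        moreover have "es ! 0 \<in> edges G" using esE len(4) by (meson length_greater_0_conv nth_mem subsetD)
        ultimately show False using edge[of 0] ends_neq[of "es ! 0" "vs ! 0" "vs ! 0"] by (simp add: n_def)
      qed
      then have n2: "2 \<le> n" using i(1) by simp
      then have i': "i' < n" "i' \<noteq> i" "Suc i' mod n = i"
        using add_mod_neq[of i n "n - 1"] i(1) by (auto simp: i'_def mod_Suc_eq)
      have in_m: "m \<in> ends G (es ! i)" "m \<in> ends G (es ! i')"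
        using edge[of i] edge[of i'] i i' by (auto simp: m_def n_def)
      have top_m: "top c = \<rho> m" if "c \<in> set es" "m \<in> ends G c" for c
        using that top_le[OF that(1)] esE orient[of c] top[of c] by (force simp: top_def)
      have neq: "es ! i \<noteq> es ! i'" using len(2) i' i(1) by (simp add: nth_eq_iff_index_eq n_def)
      have mem: "es ! i \<in> set es" "es ! i' \<in> set es" using i i' by (auto simp: n_def)
      have topsel: "c = d" if cd: "c \<in> sel h" "d \<in> sel h" "top c = top d" for c d
      proof -
        obtain v w where vw: "v \<in> verts G" "h v = Some c" "w \<in> verts G" "h w = Some d"
          using cd by (auto simp: sel_def)
        then have "\<rho> v = \<rho> w" using cd(3) back_top sel_back[OF h] by metis
        then show ?thesis using vw \<rho> by (auto dest: inj_onD)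
      qed
      \<comment> \<open>Otherwise both edges with top \<open>m\<close> would be selected, although
        \<open>m\<close> selects at most one.\<close>
      have "e = es ! i \<or> e = es ! i'"
        using topsel[of "es ! i" "es ! i'"] neq mem sub top_m in_m by auto
      then have tope: "top e = \<rho> m" using top_m mem in_m by auto
      have all_top: "top c = \<rho> m" if "c \<in> set es" for c
      proof -
        have "top e \<le> top c" using e(2)[OF that] by (auto simp: k_def less_eq_prod_def)
        then show ?thesis using tope top_le[OF that] by simp
      qed
      have m_all: "m \<in> ends G c" if cc: "c \<in> set es" for c
      proof -
        obtain u v where uv: "ends G c = {u, v}" "\<rho> u < \<rho> v" "v \<in> verts G" using orient[of c] cc esE by blast
        have "m \<in> verts G" using in_m ends_subset[of "es ! i"] mem esE by auto
        moreover have "\<rho> v = \<rho> m" using all_top[OF cc] top[OF uv(1,2)] by simp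
        ultimately have "v = m" using uv(3) \<rho> by (auto dest: inj_onD)
        then show ?thesis using uv by simp
      qed
      \<comment> \<open>The cycle edge leaving the successor of \<open>m\<close> can contain
        \<open>m\<close> only if the cycle has length 2, and then its two edges are
        parallel.\<close>
      define j where "j = Suc i mod n"
      have j: "j < n" "j \<noteq> i" using n2 i(1) add_mod_neq[of i n 1] by (auto simp: j_def)
      have "m = vs ! (Suc j mod n)"
        using m_all[of "es ! j"] edge[of j] j i(1) len by (auto simp: m_def n_def nth_eq_iff_index_eq)
      then have "i = Suc j mod n"
        using len i(1) j(1) by (auto simp: m_def n_def nth_eq_iff_index_eq)
      then have "ends G (es ! j) = ends G (es ! i)"
        using edge[of i] edge[of j] i(1) j(1) unfolding n_def[symmetric] j_def[symmetric]
        by (simp add: insert_commute)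
      then have "es ! j = es ! i" using inj_ends esE j(1) i(1) unfolding n_def
        by (meson inj_onD nth_mem subsetD)
      then show False using len(2) j i(1) by (simp add: nth_eq_iff_index_eq n_def)
    qed
    moreover have "sel h \<subseteq> edges G" using sel_back[OF h] by (auto simp: sel_def back_edges_def)
    ultimately show "sel h \<in> NBC" by (simp add: NBC_def)
  qed
  moreover have "finite NBC" using finite_edges by (simp add: NBC_def)
  ultimately have "(\<Prod>v\<in>verts G. card (back_edges \<rho> v) + 1) \<le> card NBC"
    by (metis card_inj_on_le)
  then show ?thesis unfolding tutte_2_0_eq[OF inj_k] NBC_def \<C>_def of_nat_le_iff .
qed

end

section \<open>The theorem\<close>

text \<open>Serves to prolong the order of the core to the vertices on no cycle; fresh labels exist
  because the reals are infinite.\<close>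

lemma inj_on_extend_real:
  fixes \<rho> :: "'v \<Rightarrow> real"
  assumes "finite V" "inj_on \<rho> W" "W \<subseteq> V"
  shows "\<exists>\<rho>'. inj_on \<rho>' V \<and> (\<forall>w\<in>W. \<rho>' w = \<rho> w)"
proof -
  have "finite U \<Longrightarrow> W \<inter> U = {} \<Longrightarrow> \<exists>\<rho>'. inj_on \<rho>' (W \<union> U) \<and> (\<forall>w\<in>W. \<rho>' w = \<rho> w)" for U
  proof (induction U rule: finite_induct)
    case empty
    then show ?case using assms(2) by auto
  next
    case (insert x U)
    then obtain \<rho>' where \<rho>': "inj_on \<rho>' (W \<union> U)" "\<forall>w\<in>W. \<rho>' w = \<rho> w" by auto
    have "finite (\<rho>' ` (W \<union> U))" using assms insert.hyps finite_subset by auto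
    then obtain c where c: "c \<notin> \<rho>' ` (W \<union> U)" using ex_new_if_finite infinite_UNIV_char_0 by blast
    have "x \<notin> W \<union> U" using insert by auto
    then have "inj_on (\<rho>'(x := c)) (W \<union> insert x U)"
      using \<rho>'(1) c by (auto simp: inj_on_def)
    moreover have "\<forall>w\<in>W. (\<rho>'(x := c)) w = \<rho> w" using \<rho>'(2) \<open>x \<notin> W \<union> U\<close> by auto
    ultimately show ?case by blast
  qed
  from this[of "V - W"] show ?thesis using assms by (simp add: Un_absorb1)
qed

context simple_graph
begin

text \<open>A bipolar order of \<open>core\<close> bounds the number of bases by the product over
  the core vertices. Extending it to all of \<open>G\<close> can only add back edges and vertices,
  hence enlarge the product. Without cycles there is a single base, and one edge makes the product
  exceed 1.\<close>

lemma tau_less_prod: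
  assumes deg: "\<And>v. v \<in> verts G \<Longrightarrow> card {e \<in> edges G. v \<in> ends G e} \<le> 3"
    and nonempty: "edges G \<noteq> {}"
  shows "\<exists>\<rho>. inj_on \<rho> (verts G) \<and> tau G < real (\<Prod>v\<in>verts G. card (back_edges \<rho> v) + 1)"
proof -
  have finB: "finite (back_edges \<rho> v)" for \<rho> v using finite_edges by (simp add: back_edges_def)
  have adj_verts: "Domain (adj core) \<subseteq> verts G"
    using ends_subset core_subset by (auto simp: adj_def)
  have deg_adj: "card (adj core `` {x}) \<le> 3" for x
  proof (cases "x \<in> verts G")
    case True
    define f where "f = (\<lambda>e. THE u. ends G e = {x, u})"
    have f: "f e = u" if "ends G e = {x, u}" for e u
      unfolding f_def using that by (intro the_equality) (auto simp: doubleton_eq_iff)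
    have sub: "adj core `` {x} \<subseteq> f ` {e \<in> edges G. x \<in> ends G e}"
    proof
      fix u assume "u \<in> adj core `` {x}"
      then obtain e where "e \<in> core" "ends G e = {x, u}" by (auto simp: adj_def)
      then show "u \<in> f ` {e \<in> edges G. x \<in> ends G e}"
        using f core_subset by (intro image_eqI[of _ _ e]) auto
    qed
    have "finite {e \<in> edges G. x \<in> ends G e}" using finite_edges by simp
    then show ?thesis using surj_card_le[OF _ sub] deg[OF True] by (rule_tac order_trans)
  next
    case False
    then have "adj core `` {x} = {}" using adj_verts by auto
    then show ?thesis by simp
  qed
  have "adj core \<subseteq> verts G \<times> verts G"
  proof (intro subrelI SigmaI)
    fix a b assume ab: "(a, b) \<in> adj core"
    then have "(b, a) \<in> adj core" by (subst adj_commute)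
    with ab show "a \<in> verts G" "b \<in> verts G" using adj_verts by blast+
  qed
  then have "finite (adj core)" using finite_verts finite_subset by blast
  then interpret bridgeless "adj core"
    using sym_adj deg_adj core_no_bridge adj_neq[OF core_subset] by unfold_locales blast+
  obtain \<rho>0 S T where bip: "bipolar_on (adj core) (Domain (adj core)) \<rho>0 S T"
    using bipolar_order_exists by blast
  interpret bipolar_graph G \<rho>0 S T by unfold_locales (rule bip)
  obtain \<rho> where \<rho>: "inj_on \<rho> (verts G)" "\<And>w. w \<in> Domain (adj core) \<Longrightarrow> \<rho> w = \<rho>0 w"
    using inj_on_extend_real[OF finite_verts bp(2) adj_verts] by blast
  \<comment> \<open>\<open>below v\<close> consists of vertices, \<open>back_edges \<rho> v\<close>
    of edges; sending an edge to its lower end covers \<open>below v\<close>.\<close>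
  have below: "card (below v) \<le> card (back_edges \<rho> v)" if v: "v \<in> Domain (adj core)" for v
  proof -
    define f where "f = (\<lambda>e. THE u. ends G e = {u, v})"
    have f: "f e = u" if "ends G e = {u, v}" for e u
      unfolding f_def using that by (intro the_equality) (auto simp: doubleton_eq_iff)
    have "below v \<subseteq> f ` back_edges \<rho> v"
    proof
      fix u assume "u \<in> below v"
      then have u: "(v, u) \<in> adj core" "\<rho>0 u < \<rho>0 v" by (auto simp: below_def)
      then obtain e where e: "e \<in> core" "ends G e = {u, v}" by (auto simp: adj_def insert_commute)
      have "\<rho> u < \<rho> v" using u \<rho>(2) v DomainD[OF u(1)] by simp
      then show "u \<in> f ` back_edges \<rho> v"
        using f e core_subset by (intro image_eqI[of _ _ e]) (auto simp: back_edges_def)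
    qed
    then show ?thesis by (rule surj_card_le[OF finB])
  qed
  have mono: "(\<Prod>v\<in>A. card (back_edges \<rho> v) + 1) \<le> (\<Prod>v\<in>verts G. card (back_edges \<rho> v) + 1)"
    if "A \<subseteq> verts G" for A
    using finite_verts that by (intro dvd_imp_le prod_dvd_prod_subset) (auto intro: prod_pos)
  have "card bases < (\<Prod>v\<in>verts G. card (back_edges \<rho> v) + 1)"
  proof (cases "adj core = {}")
    case False
    have "card bases < (\<Prod>v\<in>Domain (adj core). card (below v) + 1)"
      using card_bases_le card_nonmutual_less[OF False] by simp
    also have "\<dots> \<le> (\<Prod>v\<in>Domain (adj core). card (back_edges \<rho> v) + 1)"
      using below by (intro prod_mono) auto
    also have "\<dots> \<le> (\<Prod>v\<in>verts G. card (back_edges \<rho> v) + 1)"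
      by (rule mono[OF adj_verts])
    finally show ?thesis .
  next
    case True
    obtain e where e: "e \<in> edges G" using nonempty by blast
    obtain u v where uv: "ends G e = {u, v}" "u \<noteq> v" "u \<in> verts G" "v \<in> verts G"
      using ends_obtain[OF e] by blast
    then have "\<rho> u \<noteq> \<rho> v" using \<rho>(1) by (auto dest: inj_onD)
    then consider "\<rho> u < \<rho> v" | "\<rho> v < \<rho> u" by linarith
    then have "e \<in> back_edges \<rho> u \<or> e \<in> back_edges \<rho> v"
      using uv(1) e by cases (auto simp: back_edges_def insert_commute)
    then obtain w where w: "w \<in> verts G" "e \<in> back_edges \<rho> w" using uv by blast
    have "card bases \<le> 1" using card_bases_le True by (simp add: nonmutual_def)
    also have "1 < card (back_edges \<rho> w) + 1" using w(2) finB by (auto simp: card_gt_0_iff)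
    also have "\<dots> = (\<Prod>v\<in>{w}. card (back_edges \<rho> v) + 1)" by simp
    also have "\<dots> \<le> (\<Prod>v\<in>verts G. card (back_edges \<rho> v) + 1)"
      using w(1) by (intro mono) auto
    finally show ?thesis .
  qed
  then have "tau G < real (\<Prod>v\<in>verts G. card (back_edges \<rho> v) + 1)"
    unfolding tau_eq_card_bases of_nat_less_iff .
  then show ?thesis using \<rho>(1) by blast
qed

end

section \<open>From girth to simplicity, and the conclusion\<close>

lemma girth_le: "is_cycle G vs es \<Longrightarrow> girth G \<le> enat (length es)"
  unfolding girth_def by (rule Inf_lower) auto

lemma simple_graph_if_girth:
  assumes fin: "finite_graph G" and girth: "3 \<le> girth G"
  shows "simple_graph G"
proof
  have long: "3 \<le> length es" if "is_cycle G vs es" for vs es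
    using order_trans[OF girth girth_le[OF that]] by (simp add: numeral_eq_enat)
  show "finite (verts G)" "finite (edges G)" using fin by (auto simp: finite_graph_def)
  show two: "card (ends G e) = 2" if e: "e \<in> edges G" for e
  proof -
    have "card (ends G e) \<noteq> 1"
    proof
      assume "card (ends G e) = 1"
      then obtain v where "ends G e = {v}" by (meson card_1_singletonE)
      then have "is_cycle G [v] [e]" using e by (simp add: is_cycle_def)
      then show False using long by fastforce
    qed
    then show ?thesis using fin e by (auto simp: finite_graph_def)
  qed
  show "ends G e \<subseteq> verts G" if "e \<in> edges G" for e using fin that by (auto simp: finite_graph_def)
  show "inj_on (ends G) (edges G)"
  proof (rule inj_onI, rule ccontr)
    fix e f assume ef: "e \<in> edges G" "f \<in> edges G" "ends G e = ends G f" "e \<noteq> f"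
    obtain u v where "ends G e = {u, v}" "u \<noteq> v" using two[OF ef(1)] by (meson card_2_iff)
    then have "is_cycle G [u, v] [e, f]"
      using ef by (auto simp: is_cycle_def less_Suc_eq nth_Cons split: nat.splits)
    then show False using long by fastforce
  qed
qed

theorem theorem5p3:
  fixes G :: "('v, 'e) mgraph"
  assumes "finite_graph G"
    and "verts G \<noteq> {}"
    and "regular 3 G"
    and "girth G \<ge> 5"
  shows "tau G < real (alpha G) \<and>
    max (tutte (cycle_matroid G) 2 0) (tutte (cycle_matroid G) 0 2)
      \<ge> (tutte (cycle_matroid G) 1 1 :: real)"
proof -
  have "3 \<le> girth G" using assms(4) by (rule order_trans[rotated]) simp
  then interpret simple_graph G using assms(1) by (intro simple_graph_if_girth)
  have loopfree: "{e \<in> edges G. ends G e = {v}} = {}" for v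
    using card_ends by fastforce
  have deg: "card {e \<in> edges G. v \<in> ends G e} = 3" if "v \<in> verts G" for v
    using assms(3) that unfolding regular_def degree_def loopfree by simp
  have "edges G \<noteq> {}"
    using deg assms(2) by fastforce
  \<comment> \<open>One labelling serves both claims: its product exceeds \<open>tau G\<close> and
    is at most the number of acyclic orientations as well as at most T(2,0).\<close>
  then obtain \<rho> where \<rho>: "inj_on \<rho> (verts G)" "tau G < real (\<Prod>v\<in>verts G. card (back_edges \<rho> v) + 1)"
    using tau_less_prod deg by (metis order_refl)
  have "tau G < real (alpha G)"
    using \<rho>(2) alpha_ge_prod[OF \<rho>(1)] by linarith
  moreover have "tutte (cycle_matroid G) 1 1 \<le> (tutte (cycle_matroid G) 2 0 :: real)"
    using \<rho>(2) tutte_2_0_ge_prod[OF \<rho>(1)] unfolding tau_def by linarith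
  ultimately show ?thesis by simp
qed

end
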